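(* Let $0<p\le\infty$, $m,n\in\mathbb{N}$, let $\mathsf{X}\subset\mathbb{R}^m$ be a nonempty bounded Lebesgue measurable set, $\mathbb{X}$ the measure space consisting of $\mathsf{X}$ with the Lebesgue $\sigma$-algebra and Lebesgue measure $\lambda$, and $\mathsf{F}$ a Banach space. Let $h_1,\dots,h_n:\mathsf{X}\to\mathsf{X}$ be $C^1$-diffeomorphisms onto their images $\mathsf{X}_i:=h_i(\mathsf{X})$ such that $\mathsf{X}$ is the disjoint union of $\mathsf{X}_1,\dots,\mathsf{X}_n$. The system of functional equations, respectively the fractal interpolation problem, $$\psi(h_i(x))=q_i(x)+s_i(x)\,\psi(x),\qquad x\in\mathsf{X},\ i=1,\dots,n,$$ has a unique solution $\psi\in L^p(\mathbb{X},\mathsf{F})$, respectively the Read-Bajraktarević operator $$Tf(x)=(q_i\circ h_i^{-1})(x)+(s_i\circ h_i^{-1})(x)\cdot(f\circ h_i^{-1})(x),\qquad x\in\mathsf{X}_i,\ i=1,\dots,n,$$ has a unique fixed point $\psi\in L^p(\mathbb{X},\mathsf{F})$, provided that (1) $q_i\in L^p(\mathbb{X},\mathsf{F})$ and $s_i\in L^\infty(\mathbb{X},\mathbb{R})$ for $i=1,\dots,n$; and (2) $\gamma<1$, where $$\gamma:=\begin{cases}\displaystyle\sum_{i=1}^n\ \sup_{x\in\mathsf{X}}\big\{|\det (Dh_i)(x)|\,|s_i(x)|^p\big\}, & 0<p<\infty,\\[2mm] \displaystyle\max_{1\le i\le n}\ \sup_{x\in\mathsf{X}}|s_i(x)|,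 & p=\infty.\end{cases}$$
   Context: $L^p(\mathbb{X},\mathsf{F})$ is the Bochner-Lebesgue space of (equivalence classes, modulo equality almost everywhere, of) Bochner measurable functions $f:\mathsf{X}\to\mathsf{F}$ with $\int_{\mathsf{X}}\|f(x)\|_{\mathsf{F}}^p\,d\lambda(x)<\infty$ if $0<p<\infty$, and $\operatorname{ess\,sup}_{x\in\mathsf{X}}\|f(x)\|_{\mathsf{F}}<\infty$ if $p=\infty$. For $1\le p\le\infty$ it carries the usual norm; for $0<p<1$ it carries the complete translation-invariant metric $d_p(f,g)=\int_{\mathsf{X}}\|f(x)-g(x)\|_{\mathsf{F}}^p\,d\lambda(x)$. Equations between elements of $L^p$ are understood almost everywhere. A map $h$ on $\mathsf{X}$ is a $C^1$-diffeomorphism onto its image if it is the restriction to $\mathsf{X}$ of a $C^1$-diffeomorphism $g$ from an open set containing $\mathsf{X}$ onto an open subset of $\mathbb{R}^m$; $Dh:=Dg|_{\mathsf{X}}$ denotes its derivative.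
   Formalization: For p<∞ it is additionally assumed that ∫_X |det Dh_i|·‖q_i‖^p dλ < ∞ for each i (that is, q_i∘h_i^{-1} lies in L^p(X_i,F)); without this the claim fails when det Dh_i is unbounded on X, and the condition is necessary for a solution in L^p to exist. *)

theory Defs
  imports "HOL-Analysis.Analysis" "HOL-Probability.Essential_Supremum"
begin

(* Strong measurability: for a non-separable range space this is stronger than borel_measurable. *)
definition bochner_measurable :: "'a measure \<Rightarrow> ('a \<Rightarrow> 'b::real_normed_vector) \<Rightarrow> bool" where
  "bochner_measurable M f \<longleftrightarrow>
     (\<exists>u. (\<forall>k::nat. simple_function M (u k)) \<and> (AE x in M. (\<lambda>k. u k x) \<longlonglongrightarrow> f x))"

(* The elements are representatives; two of them denote the same element of L^p
   iff they agree almost everywhere. *)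
definition Lp_space :: "ennreal \<Rightarrow> 'a measure \<Rightarrow> ('a \<Rightarrow> 'b::real_normed_vector) set" where
  "Lp_space p M = {f. bochner_measurable M f \<and>
     (if p = \<infinity> then esssup M (\<lambda>x. ennreal (norm (f x))) < \<infinity>
      else (\<integral>\<^sup>+ x. ennreal (norm (f x) powr enn2real p) \<partial>M) < \<infinity>)}"

definition C1_on :: "(real ^ 'm) set \<Rightarrow> (real ^ 'm \<Rightarrow> real ^ 'm) \<Rightarrow> bool" where
  "C1_on U g \<longleftrightarrow> g differentiable_on U \<and> continuous_on U (\<lambda>x. jacobian g (at x))"

definition C1_diffeo :: "(real ^ 'm) set \<Rightarrow> (real ^ 'm) set \<Rightarrow> (real ^ 'm \<Rightarrow> real ^ 'm) \<Rightarrow> bool" where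
  "C1_diffeo U V g \<longleftrightarrow> open U \<and> open V \<and> bij_betw g U V \<and>
     C1_on U g \<and> C1_on V (the_inv_into U g)"

(* h is a C^1-diffeomorphism from X onto its image iff such a g exists; Dh is then the restriction
   of Dg to X. It may depend on g at points of X that are not accumulation points in enough
   directions, so g is kept as a parameter. *)
definition C1_diffeo_extension ::
    "(real ^ 'm) set \<Rightarrow> (real ^ 'm \<Rightarrow> real ^ 'm) \<Rightarrow> (real ^ 'm \<Rightarrow> real ^ 'm) \<Rightarrow> bool" where
  "C1_diffeo_extension X h g \<longleftrightarrow>
     (\<exists>U V. X \<subseteq> U \<and> C1_diffeo U V g \<and> (\<forall>x\<in>X. h x = g x))"

(* Extended-real valued, so that an unbounded supremum is infinite. *)
definition fif_gamma ::
    "ennreal \<Rightarrow> (real ^ 'm) set \<Rightarrow> nat \<Rightarrow> (nat \<Rightarrow> real ^ 'm \<Rightarrow> real ^ 'm) \<Rightarrow>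
     (nat \<Rightarrow> real ^ 'm \<Rightarrow> real) \<Rightarrow> ennreal" where
  "fif_gamma p X n g s =
     (if p = \<infinity> then Max ((\<lambda>i. SUP x\<in>X. ennreal \<bar>s i x\<bar>) ` {1..n})
      else (\<Sum>i=1..n. SUP x\<in>X.
              ennreal (\<bar>det (jacobian (g i) (at x))\<bar> * \<bar>s i x\<bar> powr enn2real p)))"

definition solves_fif_system ::
    "(real ^ 'm) set \<Rightarrow> nat \<Rightarrow> (nat \<Rightarrow> real ^ 'm \<Rightarrow> real ^ 'm) \<Rightarrow>
     (nat \<Rightarrow> real ^ 'm \<Rightarrow> 'f::real_normed_vector) \<Rightarrow> (nat \<Rightarrow> real ^ 'm \<Rightarrow> real) \<Rightarrow>
     (real ^ 'm \<Rightarrow> 'f) \<Rightarrow> bool" where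
  "solves_fif_system X n h q s \<psi> \<longleftrightarrow>
     (\<forall>i\<in>{1..n}. AE x in lebesgue_on X. \<psi> (h i x) = q i x + s i x *\<^sub>R \<psi> x)"

(* Only meaningful on X, and when the sets h i ` X partition X. *)
definition RB_operator ::
    "(real ^ 'm) set \<Rightarrow> nat \<Rightarrow> (nat \<Rightarrow> real ^ 'm \<Rightarrow> real ^ 'm) \<Rightarrow>
     (nat \<Rightarrow> real ^ 'm \<Rightarrow> 'f::real_normed_vector) \<Rightarrow> (nat \<Rightarrow> real ^ 'm \<Rightarrow> real) \<Rightarrow>
     (real ^ 'm \<Rightarrow> 'f) \<Rightarrow> real ^ 'm \<Rightarrow> 'f" where
  "RB_operator X n h q s f x =
     (let i = (THE i. i \<in> {1..n} \<and> x \<in> h i ` X);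
          y = the_inv_into X (h i) x
      in q i y + s i y *\<^sub>R f y)"

end

theory Submission
  imports Defs
begin

text \<open>
Let \<open>\<sigma> : X \<rightarrow> X\<close> be the map that undoes every \<open>h i\<close>, that is \<open>\<sigma> (h i x) = x\<close>, and let \<open>Q y\<close> and
\<open>S y\<close> be the values of \<open>q i\<close> and \<open>s i\<close> at \<open>\<sigma> y\<close> for \<open>y\<close> in \<open>h i ` X\<close>. The Read-Bajraktarevic operator is
then \<open>T f = Q + S \<cdot> (f \<circ> \<sigma>)\<close>, and the functional equations say, piece by piece, that \<open>T \<psi> = \<psi>\<close>.

Iterating \<open>T\<close> from 0 suggests as fixed point the series
\<open>\<psi> y = Q y + S y * Q (\<sigma> y) + S y * S (\<sigma> y) * Q (\<sigma> (\<sigma> y)) + \<dots>\<close>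
(\<open>orbit_sum\<close>), which satisfies the equation wherever it converges. That it converges almost
everywhere to an element of \<open>L\<^sup>p\<close>, and that it is the only solution there, both come from a single
estimate for the linear part of \<open>T\<close>. For finite \<open>p\<close> the change of variables \<open>y = h i x\<close> gives
\<open>\<integral> \<bar>S\<bar>\<^sup>p \<cdot> (w \<circ> \<sigma>) \<le> \<gamma> \<cdot> \<integral> w\<close> for all nonnegative measurable \<open>w\<close> (\<open>RB_contraction\<close>), so the \<open>k\<close>-th term \<open>a\<^sub>k\<close>
of the series satisfies \<open>\<integral> \<bar>a\<^sub>k\<bar>\<^sup>p \<le> \<gamma>\<^sup>k \<cdot> \<integral> \<bar>Q\<bar>\<^sup>p\<close>. With \<open>\<gamma> < \<rho> < 1\<close>, the function
\<open>K = \<Sum>k. \<bar>a\<^sub>k\<bar>\<^sup>p / \<rho>\<^sup>k\<close> is integrable, and the pointwise bound \<open>\<bar>a\<^sub>k\<bar>\<^sup>p \<le> K \<cdot> \<rho>\<^sup>k\<close> gives convergence and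
\<open>\<bar>\<psi>\<bar>\<^sup>p \<le> const \<cdot> K\<close> (\<open>orbit_sum_unique_Lp_finite\<close>). This argument replaces the contraction principle in \<open>L\<^sup>p\<close>
and does not distinguish between the metric for \<open>p < 1\<close> and the norm for \<open>p \<ge> 1\<close>. For \<open>p = \<infinity>\<close> the terms are
bounded by \<open>\<gamma>\<^sup>k\<close> times the essential bound of \<open>Q\<close> (\<open>orbit_sum_unique_Lp_infinity\<close>).

Two facts carry the passage between points and classes of functions. Since the \<open>h i\<close> and their inverses
are differentiable, they preserve null sets in both directions. And since values lie in an arbitrary
Banach space, the measurability of the sum is strong measurability, which survives limits almost
everywhere on the finite complete measure space \<open>X\<close> (\<open>bochner_measurable_limit\<close>).
\<close>

section \<open>Bochner measurable functions\<close>

lemma complete_measure_lebesgue_on: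
  assumes X: "X \<in> sets lebesgue"
  shows "complete_measure (lebesgue_on X)"
proof
  fix A B assume "B \<subseteq> A" "A \<in> null_sets (lebesgue_on X)"
  then show "B \<in> sets (lebesgue_on X)"
    by (metis X null_sets_restrict_space completion.complete2 null_setsD2 subset_trans)
qed

lemma bochner_measurable_simple: "simple_function M f \<Longrightarrow> bochner_measurable M f"
  unfolding bochner_measurable_def by (intro exI[of _ "\<lambda>_. f"]) auto

lemma bochner_measurable_cong:
  assumes f: "bochner_measurable M f" and eq: "\<And>x. x \<in> space M \<Longrightarrow> f x = g x"
  shows "bochner_measurable M g"
proof -
  obtain u where u: "\<And>k. simple_function M (u k)" "AE x in M. (\<lambda>k. u k x) \<longlonglongrightarrow> f x"
    using f unfolding bochner_measurable_def by blast
  from u(2) AE_space have "AE x in M. (\<lambda>k. u k x) \<longlonglongrightarrow> g x"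
    by eventually_elim (simp add: eq)
  with u(1) show ?thesis unfolding bochner_measurable_def by blast
qed

lemma bochner_measurable_const: "bochner_measurable M (\<lambda>_. c)"
  by (rule bochner_measurable_simple) simp

lemma bochner_measurable_continuous2:
  assumes f: "bochner_measurable M f" and g: "bochner_measurable M g"
    and t: "\<And>u v x y. u \<longlonglongrightarrow> x \<Longrightarrow> v \<longlonglongrightarrow> y \<Longrightarrow> (\<lambda>k. t (u k) (v k)) \<longlonglongrightarrow> t x y"
  shows "bochner_measurable M (\<lambda>x. t (f x) (g x))"
proof -
  obtain u v where u: "\<And>k. simple_function M (u k)" "AE x in M. (\<lambda>k. u k x) \<longlonglongrightarrow> f x"
    and v: "\<And>k. simple_function M (v k)" "AE x in M. (\<lambda>k. v k x) \<longlonglongrightarrow> g x"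
    using f g unfolding bochner_measurable_def by blast
  have "AE x in M. (\<lambda>k. t (u k x) (v k x)) \<longlonglongrightarrow> t (f x) (g x)"
    using u(2) v(2) by eventually_elim (rule t)
  then show ?thesis
    unfolding bochner_measurable_def
    by (intro exI[of _ "\<lambda>k x. t (u k x) (v k x)"]) (auto intro: simple_function_compose2 u v)
qed

lemma bochner_measurable_add:
  "bochner_measurable M f \<Longrightarrow> bochner_measurable M g \<Longrightarrow> bochner_measurable M (\<lambda>x. f x + g x)"
  by (erule (1) bochner_measurable_continuous2) (rule tendsto_add)

lemma bochner_measurable_diff:
  "bochner_measurable M f \<Longrightarrow> bochner_measurable M g \<Longrightarrow> bochner_measurable M (\<lambda>x. f x - g x)"
  by (erule (1) bochner_measurable_continuous2) (rule tendsto_diff)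

lemma bochner_measurable_scaleR:
  "bochner_measurable M f \<Longrightarrow> bochner_measurable M g \<Longrightarrow> bochner_measurable M (\<lambda>x. f x *\<^sub>R g x)"
  by (erule (1) bochner_measurable_continuous2) (rule tendsto_scaleR)

lemma bochner_measurable_norm:
  "bochner_measurable M f \<Longrightarrow> bochner_measurable M (\<lambda>x. norm (f x))"
  by (rule bochner_measurable_continuous2[of M f f "\<lambda>x y. norm x"]) (auto intro: tendsto_norm)

lemma bochner_measurable_sum:
  "(\<And>i. i \<in> I \<Longrightarrow> bochner_measurable M (f i)) \<Longrightarrow> bochner_measurable M (\<lambda>x. \<Sum>i\<in>I. f i x)"
  by (induction I rule: infinite_finite_induct)
    (auto intro: bochner_measurable_add bochner_measurable_const)

lemma bochner_measurable_indicator: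
  "A \<in> sets M \<Longrightarrow> bochner_measurable M (indicator A :: _ \<Rightarrow> real)"
  by (rule bochner_measurable_simple) simp

lemma bochner_measurable_comp:
  assumes f: "bochner_measurable N f" and T: "T \<in> M \<rightarrow>\<^sub>M N"
    and null: "\<And>P. AE x in N. P x \<Longrightarrow> AE x in M. P (T x)"
  shows "bochner_measurable M (\<lambda>x. f (T x))"
proof -
  obtain u where u: "\<And>k. simple_function N (u k)" "AE x in N. (\<lambda>k. u k x) \<longlonglongrightarrow> f x"
    using f unfolding bochner_measurable_def by blast
  then show ?thesis
    unfolding bochner_measurable_def
    by (intro exI[of _ "\<lambda>k x. u k (T x)"]) (auto intro: simple_function_comp[OF T] null)
qed

text \<open>In a complete measure space an exceptional null set cannot destroy measurability. This is what makes
limits almost everywhere of simple functions, and hence norms of Bochner measurable functions,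
measurable.\<close>

lemma (in complete_measure) borel_measurable_AE_eq:
  assumes f: "f \<in> M \<rightarrow>\<^sub>M N" and eq: "AE x in M. f x = g x" and g: "\<And>x. x \<in> space M \<Longrightarrow> g x \<in> space N"
  shows "g \<in> M \<rightarrow>\<^sub>M N"
proof (rule measurableI)
  fix A assume A: "A \<in> sets N"
  show "g -` A \<inter> space M \<in> sets M"
    by (rule in_sets_AE[of "f -` A \<inter> space M"]) (use eq A f in \<open>auto elim: eventually_mono\<close>)
qed (rule g)

lemma (in complete_measure) borel_measurable_AE_limit:
  fixes f :: "'a \<Rightarrow> real"
  assumes u: "\<And>k. u k \<in> borel_measurable M" and lim: "AE x in M. (\<lambda>k. u k x) \<longlonglongrightarrow> f x"
  shows "f \<in> borel_measurable M"
proof (rule borel_measurable_AE_eq)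
  show "(\<lambda>x. lim (\<lambda>k. u k x)) \<in> borel_measurable M"
    using u by measurable
  show "AE x in M. lim (\<lambda>k. u k x) = f x"
    using lim by eventually_elim (rule limI)
qed simp

lemma (in complete_measure) bochner_measurable_imp_borel:
  fixes f :: "'a \<Rightarrow> real"
  assumes "bochner_measurable M f"
  shows "f \<in> borel_measurable M"
  using assms unfolding bochner_measurable_def
  by (blast intro: borel_measurable_AE_limit borel_measurable_simple_function)

lemma (in complete_measure) borel_measurable_norm_bochner:
  "bochner_measurable M f \<Longrightarrow> (\<lambda>x. norm (f x)) \<in> borel_measurable M"
  by (rule bochner_measurable_imp_borel) (rule bochner_measurable_norm)

text \<open>Since \<open>'b\<close> need not be separable, approximability by simple functions has to be shown directly. On
a finite measure space, almost everywhere convergence of the simple approximations of \<open>f k\<close> implies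
convergence in measure, here measured by the integral of the distance truncated at 1. So some simple
function \<open>v k\<close> lies within \<open>(1/2) ^ k\<close> of \<open>f k\<close>; these errors are summable, so they tend to 0
almost everywhere, as in the Borel-Cantelli lemma, and \<open>v\<close> has the same limit as \<open>f\<close>.\<close>

lemma bochner_measurable_limit:
  fixes f :: "nat \<Rightarrow> 'a \<Rightarrow> 'b::real_normed_vector"
  assumes "finite_measure M" "complete_measure M"
    and f: "\<And>k. bochner_measurable M (f k)" and lim: "AE x in M. (\<lambda>k. f k x) \<longlonglongrightarrow> g x"
  shows "bochner_measurable M g"
proof -
  interpret finite_measure M by fact
  interpret complete_measure M by fact
  have "\<exists>v. simple_function M v \<and> (\<integral>\<^sup>+ x. ennreal (min 1 (norm (f k x - v x))) \<partial>M) < ennreal ((1/2)^k)" for k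
  proof -
    obtain u where u: "\<And>j. simple_function M (u j)" "AE x in M. (\<lambda>j. u j x) \<longlonglongrightarrow> f k x"
      using f[of k] unfolding bochner_measurable_def by blast
    have m: "(\<lambda>x. norm (f k x - u j x)) \<in> borel_measurable M" for j
      by (intro borel_measurable_norm_bochner bochner_measurable_diff f bochner_measurable_simple u)
    have "(\<lambda>j. \<integral>\<^sup>+ x. ennreal (min 1 (norm (f k x - u j x))) \<partial>M) \<longlonglongrightarrow> (\<integral>\<^sup>+ x. 0 \<partial>M)"
    proof (rule nn_integral_dominated_convergence[where w = "\<lambda>_. 1"])
      show "AE x in M. (\<lambda>j. ennreal (min 1 (norm (f k x - u j x)))) \<longlonglongrightarrow> 0"
        using u(2)
      proof eventually_elim
        fix x assume "(\<lambda>j. u j x) \<longlonglongrightarrow> f k x"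
        then have "(\<lambda>j. min 1 (norm (f k x - u j x))) \<longlonglongrightarrow> min 1 (norm (f k x - f k x))"
          by (intro tendsto_intros)
        then show "(\<lambda>j. ennreal (min 1 (norm (f k x - u j x)))) \<longlonglongrightarrow> 0"
          using tendsto_ennrealI by fastforce
      qed
      show "(\<integral>\<^sup>+ x. 1 \<partial>M) < \<infinity>"
        using emeasure_finite[of "space M"] by (simp add: less_top[symmetric])
    qed (use m in \<open>auto simp: ennreal_le_1\<close>)
    then have "eventually (\<lambda>j. (\<integral>\<^sup>+ x. ennreal (min 1 (norm (f k x - u j x))) \<partial>M) < ennreal ((1/2)^k)) sequentially"
      by (rule order_tendstoD) simp
    then show ?thesis
      using u(1) by (auto simp: eventually_sequentially)
  qed
  then obtain v where v: "\<And>k. simple_function M (v k)"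
    "\<And>k. (\<integral>\<^sup>+ x. ennreal (min 1 (norm (f k x - v k x))) \<partial>M) < ennreal ((1/2)^k)"
    by metis
  have m: "(\<lambda>x. ennreal (min 1 (norm (f k x - v k x)))) \<in> borel_measurable M" for k
    by (intro measurable_compose[OF _ measurable_ennreal] borel_measurable_min borel_measurable_const borel_measurable_norm_bochner bochner_measurable_diff f bochner_measurable_simple v)
  have "(\<integral>\<^sup>+ x. (\<Sum>k. ennreal (min 1 (norm (f k x - v k x)))) \<partial>M)
      = (\<Sum>k. \<integral>\<^sup>+ x. ennreal (min 1 (norm (f k x - v k x))) \<partial>M)"
    using m by (rule nn_integral_suminf)
  also have "\<dots> \<le> (\<Sum>k. ennreal ((1/2)^k))"
    using v(2) by (intro suminf_le summableI) (auto intro: less_imp_le)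
  also have "\<dots> = ennreal (\<Sum>k. (1/2)^k)"
    by (rule suminf_ennreal2) (auto intro: summable_geometric)
  also have "\<dots> < \<infinity>" by simp
  finally have "AE x in M. (\<Sum>k. ennreal (min 1 (norm (f k x - v k x)))) \<noteq> \<infinity>"
    using m by (intro nn_integral_noteq_infinite) auto
  with lim have "AE x in M. (\<lambda>k. v k x) \<longlonglongrightarrow> g x"
  proof eventually_elim
    fix x assume lim: "(\<lambda>k. f k x) \<longlonglongrightarrow> g x"
      and fin: "(\<Sum>k. ennreal (min 1 (norm (f k x - v k x)))) \<noteq> \<infinity>"
    have "summable (\<lambda>k. min 1 (norm (f k x - v k x)))"
      using fin by (intro summable_suminf_not_top) (auto simp: top_ennreal_def)
    then have t: "(\<lambda>k. min 1 (norm (f k x - v k x))) \<longlonglongrightarrow> 0"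
      by (rule summable_LIMSEQ_zero)
    \<comment> \<open>Once the truncated distance is below 1, it is the distance itself.\<close>
    then have "eventually (\<lambda>k. min 1 (norm (f k x - v k x)) < 1) sequentially"
      by (rule order_tendstoD) simp
    then have "(\<lambda>k. norm (f k x - v k x)) \<longlonglongrightarrow> 0"
      by (intro Lim_transform_eventually[OF t]) (auto elim!: eventually_mono)
    then have "(\<lambda>k. f k x - (f k x - v k x)) \<longlonglongrightarrow> g x - 0"
      by (intro tendsto_diff lim) (rule tendsto_norm_zero_cancel)
    then show "(\<lambda>k. v k x) \<longlonglongrightarrow> g x" by simp
  qed
  with v(1) show ?thesis
    unfolding bochner_measurable_def by blast
qed

lemma bochner_measurable_suminf:
  fixes f :: "nat \<Rightarrow> 'a \<Rightarrow> 'b::real_normed_vector"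
  assumes "finite_measure M" "complete_measure M"
    and f: "\<And>k. bochner_measurable M (f k)" and sum: "AE x in M. summable (\<lambda>k. f k x)"
  shows "bochner_measurable M (\<lambda>x. \<Sum>k. f k x)"
proof (rule bochner_measurable_limit[OF assms(1,2)])
  show "bochner_measurable M (\<lambda>x. \<Sum>k<K. f k x)" for K
    by (intro bochner_measurable_sum f)
  show "AE x in M. (\<lambda>K. \<Sum>k<K. f k x) \<longlonglongrightarrow> (\<Sum>k. f k x)"
    using sum by eventually_elim (rule summable_LIMSEQ)
qed

section \<open>Affine equations along a nonsingular map\<close>

lemma Lp_space_finite_iff:
  "p \<noteq> \<infinity> \<Longrightarrow> f \<in> Lp_space p M \<longleftrightarrow>
    bochner_measurable M f \<and> (\<integral>\<^sup>+ x. ennreal (norm (f x) powr enn2real p) \<partial>M) < \<infinity>"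
  by (simp add: Lp_space_def)

lemma (in complete_measure) Lp_space_infinity_iff:
  "f \<in> Lp_space \<infinity> M \<longleftrightarrow> bochner_measurable M f \<and> (\<exists>C. AE x in M. norm (f x) \<le> C)"
proof -
  have "esssup M (\<lambda>x. ennreal (norm (f x))) < \<infinity> \<longleftrightarrow> (\<exists>C. AE x in M. norm (f x) \<le> C)"
    if f: "bochner_measurable M f"
  proof
    have m: "(\<lambda>x. ennreal (norm (f x))) \<in> borel_measurable M"
      using borel_measurable_norm_bochner[OF f] by measurable
    show "\<exists>C. AE x in M. norm (f x) \<le> C" if fin: "esssup M (\<lambda>x. ennreal (norm (f x))) < \<infinity>"
    proof -
      have "AE x in M. ennreal (norm (f x)) \<le> ennreal (enn2real (esssup M (\<lambda>x. ennreal (norm (f x)))))"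
        using esssup_AE[of "\<lambda>x. ennreal (norm (f x))" M] fin by (simp add: less_top)
      then show ?thesis
        by (auto simp: ennreal_le_iff)
    qed
    show "esssup M (\<lambda>x. ennreal (norm (f x))) < \<infinity>" if "\<exists>C. AE x in M. norm (f x) \<le> C"
    proof -
      obtain C where "AE x in M. norm (f x) \<le> C" using \<open>\<exists>C. _\<close> by blast
      then have "AE x in M. ennreal (norm (f x)) \<le> ennreal C"
        by eventually_elim (rule ennreal_leI)
      then have "esssup M (\<lambda>x. ennreal (norm (f x))) \<le> ennreal C"
        using m by (intro esssup_I) auto
      then show ?thesis
        by (simp add: le_less_trans)
    qed
  qed
  then show ?thesis
    by (auto simp: Lp_space_def)
qed

lemma powr_norm_diff_le:
  fixes a b :: "'b::real_normed_vector"
  assumes r: "0 < r"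
  shows "norm (a - b) powr r \<le> 2 powr r * (norm a powr r + norm b powr r)"
proof -
  have "norm (a - b) powr r \<le> (2 * max (norm a) (norm b)) powr r"
    using r norm_triangle_ineq4[of a b] by (intro powr_mono2) auto
  also have "\<dots> = 2 powr r * max (norm a) (norm b) powr r"
    by (simp add: powr_mult)
  also have "\<dots> \<le> 2 powr r * (norm a powr r + norm b powr r)"
    by (intro mult_left_mono) (auto simp: max_def)
  finally show ?thesis .
qed

lemma (in complete_measure) nn_integral_powr_norm_diff_finite:
  assumes r: "0 < r" and f: "bochner_measurable M f" and g: "bochner_measurable M g"
    and "(\<integral>\<^sup>+ x. ennreal (norm (f x) powr r) \<partial>M) < \<infinity>"
    and "(\<integral>\<^sup>+ x. ennreal (norm (g x) powr r) \<partial>M) < \<infinity>"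
  shows "(\<integral>\<^sup>+ x. ennreal (norm (f x - g x) powr r) \<partial>M) < \<infinity>"
proof -
  have m [measurable]: "(\<lambda>x. norm (f x)) \<in> borel_measurable M" "(\<lambda>x. norm (g x)) \<in> borel_measurable M"
    using f g by (auto intro: borel_measurable_norm_bochner)
  have "(\<integral>\<^sup>+ x. ennreal (norm (f x - g x) powr r) \<partial>M)
      \<le> (\<integral>\<^sup>+ x. ennreal (2 powr r) * (ennreal (norm (f x) powr r) + ennreal (norm (g x) powr r)) \<partial>M)"
    using powr_norm_diff_le[OF r]
    by (intro nn_integral_mono) (auto simp flip: ennreal_plus ennreal_mult intro!: ennreal_leI)
  also have "\<dots> = ennreal (2 powr r) * ((\<integral>\<^sup>+ x. ennreal (norm (f x) powr r) \<partial>M) + (\<integral>\<^sup>+ x. ennreal (norm (g x) powr r) \<partial>M))"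
    by (simp add: nn_integral_cmult nn_integral_add)
  also have "\<dots> < \<infinity>"
    using assms(4,5) by (simp add: ennreal_mult_less_top)
  finally show ?thesis .
qed

lemma ennreal_contraction_eq_0:
  fixes I c :: ennreal
  assumes "I \<le> c * I" "c < 1" "I < \<infinity>"
  shows "I = 0"
proof (rule ccontr)
  assume "I \<noteq> 0"
  then have "c * I < 1 * I"
    using assms by (intro ennreal_mult_strict_right_mono) (auto simp: zero_less_iff_neq_zero)
  then show False using assms(1) by simp
qed

text \<open>If \<open>K\<close> denotes the weighted sum, each term satisfies \<open>norm (a k) powr r \<le> K * \<rho> ^ k\<close>. Taking
\<open>r\<close>-th roots bounds \<open>a\<close> by a geometric series whose sum is a constant times the root of \<open>K\<close>. No
triangle inequality for the \<open>r\<close>-th power mean enters, so that exponents below and above 1 are treated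
alike.\<close>

lemma summable_of_weighted_powr_sum:
  fixes a :: "nat \<Rightarrow> 'f::banach"
  assumes r: "0 < r" and \<rho>: "0 < \<rho>" "\<rho> < 1"
    and fin: "(\<Sum>k. ennreal (norm (a k) powr r / \<rho> ^ k)) < \<infinity>"
  shows "summable a"
    and "ennreal (norm (suminf a) powr r) \<le> ennreal ((1 / (1 - \<rho> powr (1 / r))) powr r) * (\<Sum>k. ennreal (norm (a k) powr r / \<rho> ^ k))"
proof -
  define \<theta> where "\<theta> = \<rho> powr (1 / r)"
  have \<theta>: "0 < \<theta>" "\<theta> < 1" "\<theta> powr r = \<rho>"
    using r \<rho> powr_less_mono2[of "1/r" \<rho> 1] by (auto simp: \<theta>_def powr_powr)
  define K where "K = (\<Sum>k. norm (a k) powr r / \<rho> ^ k)"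
  have sumK: "summable (\<lambda>k. norm (a k) powr r / \<rho> ^ k)"
    using fin \<rho> by (intro summable_suminf_not_top) auto
  have K: "(\<Sum>k. ennreal (norm (a k) powr r / \<rho> ^ k)) = ennreal K"
    unfolding K_def using \<rho> by (intro suminf_ennreal2 sumK) auto
  have K0: "0 \<le> K"
    unfolding K_def using \<rho> by (intro suminf_nonneg sumK) auto
  have bound: "norm (a k) \<le> K powr (1 / r) * \<theta> ^ k" for k
  proof -
    have "norm (a k) powr r / \<rho> ^ k \<le> K"
      unfolding K_def using \<rho> sum_le_suminf[OF sumK, of "{k}"] by auto
    then have "norm (a k) powr r \<le> K * \<rho> ^ k"
      using \<rho> by (simp add: field_simps)
    then have "(norm (a k) powr r) powr (1 / r) \<le> (K * \<rho> ^ k) powr (1 / r)"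
      using r by (intro powr_mono2) auto
    also have "\<dots> = K powr (1 / r) * \<theta> ^ k"
      using \<rho> K0 by (simp add: powr_mult \<theta>_def powr_powr powr_realpow[symmetric] powr_power mult.commute)
    finally show ?thesis
      using r by (simp add: powr_powr)
  qed
  have geo: "summable (\<lambda>k. K powr (1 / r) * \<theta> ^ k)"
    using \<theta> by (intro summable_mult summable_geometric) auto
  show "summable a"
    by (rule summable_comparison_test'[OF geo]) (rule bound)
  have "norm (suminf a) \<le> (\<Sum>k. K powr (1 / r) * \<theta> ^ k)"
    by (rule norm_suminf_le[OF bound geo])
  also have "\<dots> = K powr (1 / r) * (1 / (1 - \<theta>))"
    using \<theta> by (simp add: suminf_mult suminf_geometric summable_geometric)
  finally have "norm (suminf a) powr r \<le> (K powr (1 / r) * (1 / (1 - \<theta>))) powr r"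
    using r by (intro powr_mono2) auto
  also have "\<dots> = (1 / (1 - \<theta>)) powr r * K"
    using r \<theta> K0 by (simp only: powr_mult powr_powr) simp
  finally show "ennreal (norm (suminf a) powr r) \<le> ennreal ((1 / (1 - \<rho> powr (1 / r))) powr r) * (\<Sum>k. ennreal (norm (a k) powr r / \<rho> ^ k))"
    unfolding K \<theta>_def[symmetric] using K0 by (simp add: ennreal_mult'[symmetric] ennreal_leI)
qed

text \<open>The setting of the equation \<open>\<phi> = Q + S \<cdot> (\<phi> \<circ> \<sigma>)\<close>. Preimages of null sets under \<open>\<sigma>\<close> are null, so that
the right-hand side respects equality almost everywhere.\<close>

locale affine_recursion = finite_measure M + complete_measure M for M :: "'a measure" +
  fixes \<sigma> :: "'a \<Rightarrow> 'a" and S :: "'a \<Rightarrow> real" and Q :: "'a \<Rightarrow> 'f::banach"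
  assumes shift_measurable: "\<sigma> \<in> M \<rightarrow>\<^sub>M M"
    and shift_nonsingular: "\<And>P. AE y in M. P y \<Longrightarrow> AE y in M. P (\<sigma> y)"
    and bochner_S: "bochner_measurable M S"
    and bochner_Q: "bochner_measurable M Q"
begin

text \<open>Iterating the equation from \<open>\<phi> = 0\<close> produces the partial sums of
\<open>Q y + S y * Q (\<sigma> y) + S y * S (\<sigma> y) * Q (\<sigma> (\<sigma> y)) + \<dots>\<close>; the
function below is the \<open>k\<close>-th term of this series.\<close>

primrec orbit_term :: "nat \<Rightarrow> 'a \<Rightarrow> 'f" where
  "orbit_term 0 y = Q y"
| "orbit_term (Suc k) y = S y *\<^sub>R orbit_term k (\<sigma> y)"

definition orbit_sum :: "'a \<Rightarrow> 'f" where
  "orbit_sum y = (\<Sum>k. orbit_term k y)"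

lemma bochner_orbit_term: "bochner_measurable M (orbit_term k)"
proof (induction k)
  case (Suc k)
  have "bochner_measurable M (\<lambda>y. S y *\<^sub>R orbit_term k (\<sigma> y))"
    by (intro bochner_measurable_scaleR bochner_S bochner_measurable_comp[OF Suc shift_measurable shift_nonsingular])
  then show ?case by simp
qed (simp add: bochner_Q)

text \<open>This is exact at every point of convergence. If \<open>S y = 0\<close>, all terms after the first vanish and the
value of \<^const>\<open>orbit_sum\<close> at \<open>\<sigma> y\<close>, convergent or not, is multiplied by 0; otherwise dividing by
\<open>S y\<close> turns convergence at \<open>y\<close> into convergence at \<open>\<sigma> y\<close>.\<close>

lemma orbit_sum_solves:
  assumes sum: "summable (\<lambda>k. orbit_term k y)"
  shows "orbit_sum y = Q y + S y *\<^sub>R orbit_sum (\<sigma> y)"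
proof -
  have "(\<Sum>k. S y *\<^sub>R orbit_term k (\<sigma> y)) = S y *\<^sub>R orbit_sum (\<sigma> y)"
  proof (cases "S y = 0")
    case False
    have "summable (\<lambda>k. inverse (S y) *\<^sub>R orbit_term (Suc k) y)"
      using sum by (intro summable_scaleR_right) (subst summable_Suc_iff)
    then have "summable (\<lambda>k. orbit_term k (\<sigma> y))"
      using False by simp
    then show ?thesis
      unfolding orbit_sum_def by (rule suminf_scaleR_right[symmetric])
  qed simp
  moreover have "orbit_sum y = Q y + (\<Sum>k. orbit_term (Suc k) y)"
    unfolding orbit_sum_def using suminf_split_head[OF sum] by simp
  ultimately show ?thesis by simp
qed

lemma bochner_orbit_sum:
  assumes "AE y in M. summable (\<lambda>k. orbit_term k y)"
  shows "bochner_measurable M orbit_sum"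
  unfolding orbit_sum_def[abs_def]
  by (rule bochner_measurable_suminf[OF finite_measure_axioms complete_measure_axioms bochner_orbit_term assms])

definition unique_Lp_solution :: "ennreal \<Rightarrow> ('a \<Rightarrow> 'f) \<Rightarrow> bool" where
  "unique_Lp_solution p \<psi> \<longleftrightarrow> \<psi> \<in> Lp_space p M \<and>
    (\<forall>\<phi>\<in>Lp_space p M. (AE y in M. \<phi> y = Q y + S y *\<^sub>R \<phi> (\<sigma> y)) \<longleftrightarrow> (AE y in M. \<phi> y = \<psi> y))"

text \<open>The difference of two solutions solves the homogeneous equation, so uniqueness only has to be shown
for that one. Conversely, a function equal to a solution almost everywhere is a solution because
\<open>\<sigma>\<close> is nonsingular.\<close>

lemma unique_Lp_solutionI:
  assumes Lp: "\<psi> \<in> Lp_space p M" and sol: "AE y in M. \<psi> y = Q y + S y *\<^sub>R \<psi> (\<sigma> y)"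
    and uniq: "\<And>\<phi>. \<phi> \<in> Lp_space p M \<Longrightarrow> AE y in M. \<phi> y - \<psi> y = S y *\<^sub>R (\<phi> (\<sigma> y) - \<psi> (\<sigma> y)) \<Longrightarrow>
      AE y in M. \<phi> y - \<psi> y = 0"
  shows "unique_Lp_solution p \<psi>"
  unfolding unique_Lp_solution_def
proof (intro conjI ballI iffI Lp)
  fix \<phi> :: "'a \<Rightarrow> 'f" assume \<phi>: "\<phi> \<in> Lp_space p M"
  {
    assume "AE y in M. \<phi> y = Q y + S y *\<^sub>R \<phi> (\<sigma> y)"
    with sol have "AE y in M. \<phi> y - \<psi> y = S y *\<^sub>R (\<phi> (\<sigma> y) - \<psi> (\<sigma> y))"
      by eventually_elim (simp add: algebra_simps)
    from uniq[OF \<phi> this] show "AE y in M. \<phi> y = \<psi> y"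
      by simp
  }
  assume eq: "AE y in M. \<phi> y = \<psi> y"
  from sol eq shift_nonsingular[OF eq] show "AE y in M. \<phi> y = Q y + S y *\<^sub>R \<phi> (\<sigma> y)"
    by eventually_elim simp
qed

text \<open>Each application of the homogeneous equation gains a factor \<open>c\<close> in the essential bound. For the terms
of the series this gives a convergent geometric majorant, and for a bounded homogeneous solution it
gives arbitrarily small bounds.\<close>

lemma orbit_sum_unique_Lp_infinity:
  assumes c: "0 \<le> c" "c < 1" and S: "\<And>y. y \<in> space M \<Longrightarrow> \<bar>S y\<bar> \<le> c" and Q: "Q \<in> Lp_space \<infinity> M"
  shows "unique_Lp_solution \<infinity> orbit_sum"
proof (rule unique_Lp_solutionI)
  \<comment> \<open>Applied below to the terms of the series, and to the constant sequence of a homogeneous solution.\<close>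
  have geometric_decay: "AE y in M. \<forall>k. norm (d k y) \<le> c ^ k * C"
    if 0: "AE y in M. norm (d 0 y) \<le> C"
      and Suc: "\<And>k. AE y in M. d (Suc k) y = S y *\<^sub>R d k (\<sigma> y)"
    for d :: "nat \<Rightarrow> 'a \<Rightarrow> 'f" and C
  proof -
    have "AE y in M. norm (d k y) \<le> c ^ k * C" for k
    proof (induction k)
      case (Suc k)
      from shift_nonsingular[OF Suc] \<open>\<And>k. AE y in M. d (Suc k) y = _ k y\<close>[of k] AE_space
      show ?case
      proof eventually_elim
        case (elim y)
        have "norm (d (Suc k) y) = \<bar>S y\<bar> * norm (d k (\<sigma> y))"
          using elim(2) by simp
        also have "\<dots> \<le> c * (c ^ k * C)"
          using elim(1) S[OF elim(3)] c by (intro mult_mono) auto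
        finally show ?case by simp
      qed
    qed (use 0 in simp)
    then show ?thesis by (simp add: AE_all_countable)
  qed
  obtain C where "AE y in M. norm (Q y) \<le> C"
    using Q unfolding Lp_space_infinity_iff by blast
  then have decay: "AE y in M. \<forall>k. norm (orbit_term k y) \<le> c ^ k * C"
    by (intro geometric_decay) simp_all
  have geo: "summable (\<lambda>k. c ^ k * C)"
    using c by (intro summable_mult2 summable_geometric) simp
  have sum: "AE y in M. summable (\<lambda>k. orbit_term k y)"
    using decay by eventually_elim (rule summable_comparison_test'[OF geo], blast)
  have "AE y in M. norm (orbit_sum y) \<le> (\<Sum>k. c ^ k * C)"
    using decay
  proof eventually_elim
    case (elim y)
    then show ?case
      unfolding orbit_sum_def by (intro norm_suminf_le geo) blast
  qed
  then show Lp: "orbit_sum \<in> Lp_space \<infinity> M"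
    using bochner_orbit_sum[OF sum] unfolding Lp_space_infinity_iff by blast
  show "AE y in M. orbit_sum y = Q y + S y *\<^sub>R orbit_sum (\<sigma> y)"
    using sum by eventually_elim (rule orbit_sum_solves)
  fix \<phi> :: "'a \<Rightarrow> 'f" assume \<phi>: "\<phi> \<in> Lp_space \<infinity> M"
    and eq: "AE y in M. \<phi> y - orbit_sum y = S y *\<^sub>R (\<phi> (\<sigma> y) - orbit_sum (\<sigma> y))"
  obtain C1 C2 where "AE y in M. norm (\<phi> y) \<le> C1" "AE y in M. norm (orbit_sum y) \<le> C2"
    using \<phi> Lp unfolding Lp_space_infinity_iff by blast
  then have "AE y in M. norm (\<phi> y - orbit_sum y) \<le> C1 + C2"
    by eventually_elim (smt (verit) norm_triangle_ineq4)
  then have "AE y in M. \<forall>k::nat. norm (\<phi> y - orbit_sum y) \<le> c ^ k * (C1 + C2)"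
    by (rule geometric_decay) (rule eq)
  then show "AE y in M. \<phi> y - orbit_sum y = 0"
  proof eventually_elim
    case (elim y)
    have "(\<lambda>k. c ^ k * (C1 + C2)) \<longlonglongrightarrow> 0 * (C1 + C2)"
      using c by (intro tendsto_intros LIMSEQ_power_zero) simp
    then have "norm (\<phi> y - orbit_sum y) \<le> 0"
      using elim by (intro LIMSEQ_le_const[of "\<lambda>k. c ^ k * (C1 + C2)"]) auto
    then show ?case by simp
  qed
qed

text \<open>By the contraction hypothesis the integrals of \<open>norm (orbit_term k y) powr p\<close> decay like powers of
\<open>c\<close>. Weighting them with the powers of some \<open>1 / \<rho>\<close> where \<open>c < \<rho> < 1\<close> still leaves a convergent
sum, so the weighted sum \<open>K\<close> of the functions is integrable. Hence \<open>K\<close> is finite almost everywhere,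
which forces the series to converge there, and a multiple of \<open>K\<close> dominates the \<open>p\<close>-th power of
the norm of the sum.
The integral for a homogeneous solution is finite and at most \<open>c\<close> times itself, so it is zero.\<close>

lemma orbit_sum_unique_Lp_finite:
  assumes p: "0 < p" "p \<noteq> \<infinity>" and c: "c < 1"
    and contraction: "\<And>w. w \<in> borel_measurable M \<Longrightarrow>
      (\<integral>\<^sup>+ y. ennreal (\<bar>S y\<bar> powr enn2real p) * w (\<sigma> y) \<partial>M) \<le> c * (\<integral>\<^sup>+ y. w y \<partial>M)"
    and Q: "Q \<in> Lp_space p M"
  shows "unique_Lp_solution p orbit_sum"
proof (rule unique_Lp_solutionI)
  define r where "r = enn2real p"
  have r: "0 < r"
    using p by (simp add: r_def enn2real_positive_iff less_top)
  note Lp_iff = Lp_space_finite_iff[OF p(2), folded r_def]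
  obtain c' where c': "c = ennreal c'" "0 \<le> c'" "c' < 1"
    using c by (cases c) (auto simp: ennreal_less_one_iff top_unique)
  define \<rho> where "\<rho> = (1 + c') / 2"
  have \<rho>: "0 < \<rho>" "\<rho> < 1" "c' < \<rho>" using c' by (auto simp: \<rho>_def)
  have term_meas [measurable]: "(\<lambda>y. norm (orbit_term k y)) \<in> borel_measurable M" for k
    by (rule borel_measurable_norm_bochner[OF bochner_orbit_term])
  define I where "I = (\<integral>\<^sup>+ y. ennreal (norm (Q y) powr r) \<partial>M)"
  have I: "I < \<infinity>" using Q by (auto simp: Lp_iff I_def)
  have decay: "(\<integral>\<^sup>+ y. ennreal (norm (orbit_term k y) powr r) \<partial>M) \<le> ennreal (c' ^ k) * I" for k
  proof (induction k)
    case (Suc k)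
    have "(\<integral>\<^sup>+ y. ennreal (norm (orbit_term (Suc k) y) powr r) \<partial>M)
        = (\<integral>\<^sup>+ y. ennreal (\<bar>S y\<bar> powr r) * ennreal (norm (orbit_term k (\<sigma> y)) powr r) \<partial>M)"
      by (simp add: powr_mult ennreal_mult')
    also have "\<dots> \<le> c * (\<integral>\<^sup>+ y. ennreal (norm (orbit_term k y) powr r) \<partial>M)"
      unfolding r_def by (rule contraction) measurable
    also have "\<dots> \<le> c * (ennreal (c' ^ k) * I)"
      by (intro mult_left_mono Suc) simp
    finally show ?case
      using c' by (simp add: ennreal_mult' mult.assoc)
  qed (simp add: I_def)
  define K where "K y = (\<Sum>k. ennreal (norm (orbit_term k y) powr r / \<rho> ^ k))" for y
  have K_meas [measurable]: "K \<in> borel_measurable M"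
    unfolding K_def[abs_def] by measurable
  have "(\<integral>\<^sup>+ y. K y \<partial>M) = (\<Sum>k. \<integral>\<^sup>+ y. ennreal (norm (orbit_term k y) powr r / \<rho> ^ k) \<partial>M)"
    unfolding K_def by (intro nn_integral_suminf) measurable
  also have "\<dots> \<le> (\<Sum>k. ennreal ((c' / \<rho>) ^ k) * I)"
  proof (intro suminf_le summableI)
    fix k
    have "(\<integral>\<^sup>+ y. ennreal (norm (orbit_term k y) powr r / \<rho> ^ k) \<partial>M)
        = (\<integral>\<^sup>+ y. ennreal (1 / \<rho> ^ k) * ennreal (norm (orbit_term k y) powr r) \<partial>M)"
      using \<rho> by (simp flip: ennreal_mult')
    also have "\<dots> = ennreal (1 / \<rho> ^ k) * (\<integral>\<^sup>+ y. ennreal (norm (orbit_term k y) powr r) \<partial>M)"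
      by (rule nn_integral_cmult) measurable
    also have "\<dots> \<le> ennreal (1 / \<rho> ^ k) * (ennreal (c' ^ k) * I)"
      by (intro mult_left_mono decay) simp
    also have "\<dots> = ennreal ((c' / \<rho>) ^ k) * I"
      using \<rho> c' by (simp add: mult.assoc[symmetric] power_divide flip: ennreal_mult')
    finally show "(\<integral>\<^sup>+ y. ennreal (norm (orbit_term k y) powr r / \<rho> ^ k) \<partial>M) \<le> ennreal ((c' / \<rho>) ^ k) * I" .
  qed
  also have "\<dots> = (\<Sum>k. ennreal ((c' / \<rho>) ^ k)) * I"
    by simp
  also have "(\<Sum>k. ennreal ((c' / \<rho>) ^ k)) = ennreal (\<Sum>k. (c' / \<rho>) ^ k)"
    using c' \<rho> by (intro suminf_ennreal2 summable_geometric) auto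
  also have "ennreal (\<Sum>k. (c' / \<rho>) ^ k) * I < \<infinity>"
    using I by (simp add: ennreal_mult_less_top)
  finally have K_fin: "(\<integral>\<^sup>+ y. K y \<partial>M) < \<infinity>" .
  then have "AE y in M. K y \<noteq> \<infinity>"
    by (intro nn_integral_noteq_infinite) auto
  then have K_AE: "AE y in M. K y < \<infinity>"
    by (simp add: less_top)
  have sum: "AE y in M. summable (\<lambda>k. orbit_term k y)"
    using K_AE unfolding K_def by eventually_elim (rule summable_of_weighted_powr_sum(1)[OF r \<rho>(1,2)])
  define B where "B = ennreal ((1 / (1 - \<rho> powr (1 / r))) powr r)"
  have "AE y in M. ennreal (norm (orbit_sum y) powr r) \<le> B * K y"
    using K_AE unfolding K_def orbit_sum_def B_def
    by eventually_elim (rule summable_of_weighted_powr_sum(2)[OF r \<rho>(1,2)])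
  then have "(\<integral>\<^sup>+ y. ennreal (norm (orbit_sum y) powr r) \<partial>M) \<le> (\<integral>\<^sup>+ y. B * K y \<partial>M)"
    by (rule nn_integral_mono_AE)
  also have "\<dots> = B * (\<integral>\<^sup>+ y. K y \<partial>M)"
    by (rule nn_integral_cmult) measurable
  also have "\<dots> < \<infinity>"
    using K_fin by (simp add: B_def ennreal_mult_less_top)
  finally show Lp: "orbit_sum \<in> Lp_space p M"
    by (simp add: Lp_iff bochner_orbit_sum[OF sum])
  show "AE y in M. orbit_sum y = Q y + S y *\<^sub>R orbit_sum (\<sigma> y)"
    using sum by eventually_elim (rule orbit_sum_solves)
  fix \<phi> :: "'a \<Rightarrow> 'f" assume \<phi>: "\<phi> \<in> Lp_space p M"
    and eq: "AE y in M. \<phi> y - orbit_sum y = S y *\<^sub>R (\<phi> (\<sigma> y) - orbit_sum (\<sigma> y))"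
  define D where "D y = ennreal (norm (\<phi> y - orbit_sum y) powr r)" for y
  have D_meas [measurable]: "D \<in> borel_measurable M"
  proof -
    have "(\<lambda>y. norm (\<phi> y - orbit_sum y)) \<in> borel_measurable M"
      using \<phi> Lp by (auto simp: Lp_iff intro!: borel_measurable_norm_bochner bochner_measurable_diff)
    then show ?thesis unfolding D_def[abs_def] by measurable
  qed
  have D_fin: "(\<integral>\<^sup>+ y. D y \<partial>M) < \<infinity>"
    unfolding D_def using \<phi> Lp r by (intro nn_integral_powr_norm_diff_finite) (auto simp: Lp_iff)
  have "(\<integral>\<^sup>+ y. D y \<partial>M) = (\<integral>\<^sup>+ y. ennreal (\<bar>S y\<bar> powr r) * D (\<sigma> y) \<partial>M)"
  proof (rule nn_integral_cong_AE)
    show "AE y in M. D y = ennreal (\<bar>S y\<bar> powr r) * D (\<sigma> y)"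
      using eq by eventually_elim (simp add: D_def powr_mult ennreal_mult')
  qed
  also have "\<dots> \<le> c * (\<integral>\<^sup>+ y. D y \<partial>M)"
    unfolding r_def by (rule contraction) measurable
  finally have "(\<integral>\<^sup>+ y. D y \<partial>M) = 0"
    by (rule ennreal_contraction_eq_0[OF _ c D_fin])
  then have "AE y in M. D y = 0"
    by (subst (asm) nn_integral_0_iff_AE) auto
  then show "AE y in M. \<phi> y - orbit_sum y = 0"
    by eventually_elim (simp add: D_def)
qed

end

section \<open>Change of variables for an arbitrary finite index type\<close>

text \<open>A copy of the index type ordered like the numbers below \<^term>\<open>CARD('m)\<close>. The formula for the
measure of a differentiable image (\<open>has_measure_differentiable_image\<close>) is about index types with a
well-order, while here the index type is an arbitrary finite one; relabelling the coordinates by this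
copy carries the formula over, because relabelling changes neither Lebesgue measure nor determinants.\<close>

typedef (overloaded) ('m::finite) coord_index = "{..<CARD('m)}"
  by (rule exI[of _ 0]) simp

lemma finite_UNIV_coord_index: "finite (UNIV :: 'm::finite coord_index set)"
  by (metis finite_imageI finite_lessThan type_definition.Abs_image type_definition_coord_index)

instance coord_index :: (finite) finite
  by standard (rule finite_UNIV_coord_index)

instantiation coord_index :: (finite) linorder
begin
definition "x \<le> y \<longleftrightarrow> Rep_coord_index x \<le> Rep_coord_index y"
definition "x < y \<longleftrightarrow> Rep_coord_index x < Rep_coord_index y"
instance
  by standard (auto simp: less_eq_coord_index_def less_coord_index_def Rep_coord_index_inject)
end

instance coord_index :: (finite) wellorder
  by (rule wf_wellorderI, rule wf_subset[OF wf_measure[of Rep_coord_index]])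
    (auto simp: less_coord_index_def, intro_classes)

lemma bij_coord_index: "\<exists>e :: 'm::finite coord_index \<Rightarrow> 'm. bij e"
proof -
  have "card (UNIV :: 'm coord_index set) = CARD('m)"
    by (metis card_lessThan type_definition.card type_definition_coord_index)
  then show ?thesis
    by (metis finite bij_betw_iff_card)
qed

definition reindex :: "('k::finite \<Rightarrow> 'm::finite) \<Rightarrow> real ^ 'm \<Rightarrow> real ^ 'k" where
  "reindex e v = (\<chi> k. v $ e k)"

lemma reindex_nth [simp]: "reindex e v $ k = v $ e k"
  by (simp add: reindex_def)

lemma linear_reindex: "linear (reindex e)"
  by (rule linearI) (simp_all add: vec_eq_iff)

lemma reindex_inv:
  assumes "bij e"
  shows "reindex e (reindex (inv e) v) = v" "reindex (inv e) (reindex e w) = w"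
  using assms by (auto simp: vec_eq_iff bij_is_inj bij_is_surj surj_f_inv_f)

text \<open>A box pulls back to the box whose sides are permuted, and the product of the side lengths does not
see the permutation.\<close>

lemma distr_reindex_lborel:
  fixes e :: "'k::finite \<Rightarrow> 'm::finite"
  assumes "bij e"
  shows "distr lborel lborel (reindex e) = lborel"
proof (rule lborel_eqI[symmetric])
  have m: "reindex e \<in> borel \<rightarrow>\<^sub>M borel"
    by (intro borel_measurable_continuous_onI linear_continuous_on linear_conv_bounded_linear[THEN iffD1] linear_reindex)
  fix l u :: "real ^ 'k"
  assume le: "\<And>b. b \<in> Basis \<Longrightarrow> l \<bullet> b \<le> u \<bullet> b"
  have le': "l $ k \<le> u $ k" for k
    using le[of "axis k 1"] by (simp add: axis_in_Basis_iff inner_axis)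
  have prod_axis: "(\<Prod>b\<in>Basis. w \<bullet> b) = (\<Prod>k\<in>UNIV. w $ k)" for w :: "real ^ 'i::finite"
    unfolding Basis_vec_def
    by (subst prod.UNION_disjoint) (auto simp: axis_eq_axis inner_axis)
  have box: "reindex e -` box l u = box (reindex (inv e) l) (reindex (inv e) u)"
    using assms
    by (auto simp: mem_box_cart bij_is_surj surj_f_inv_f bij_is_inj)
      (metis assms bij_inv_eq_iff)+
  have "emeasure (distr lborel lborel (reindex e)) (box l u)
      = emeasure lborel (box (reindex (inv e) l) (reindex (inv e) u))"
    using m by (subst emeasure_distr) (auto simp: box)
  also have "\<dots> = (\<Prod>b\<in>Basis. (reindex (inv e) u - reindex (inv e) l) \<bullet> b)"
    by (rule emeasure_lborel_box)
      (use le' in \<open>auto simp: Basis_vec_def inner_axis\<close>)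
  also have "(\<Prod>b\<in>Basis. (reindex (inv e) u - reindex (inv e) l) \<bullet> b) = (\<Prod>m\<in>UNIV. u $ inv e m - l $ inv e m)"
    by (simp add: prod_axis del: inner_diff_left)
  also have "\<dots> = (\<Prod>k\<in>UNIV. u $ k - l $ k)"
    by (rule prod.reindex_bij_betw[OF bij_imp_bij_inv[OF assms], of "\<lambda>k. u $ k - l $ k"])
  also have "\<dots> = (\<Prod>b\<in>Basis. (u - l) \<bullet> b)"
    by (simp add: prod_axis del: inner_diff_left)
  finally show "emeasure (distr lborel lborel (reindex e)) (box l u) = (\<Prod>b\<in>Basis. (u - l) \<bullet> b)" .
qed simp

lemma
  fixes e :: "'k::finite \<Rightarrow> 'm::finite"
  assumes "bij e"
  shows measurable_reindex_lebesgue: "reindex e \<in> lebesgue \<rightarrow>\<^sub>M lebesgue"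
    and distr_reindex_lebesgue: "distr lebesgue lebesgue (reindex e) = lebesgue"
proof -
  have m: "reindex e \<in> lborel \<rightarrow>\<^sub>M lborel"
    by (simp, intro borel_measurable_continuous_onI linear_continuous_on linear_conv_bounded_linear[THEN iffD1] linear_reindex)
  then have m': "reindex e \<in> lebesgue \<rightarrow>\<^sub>M lborel"
    by (rule measurable_completion)
  have d: "distr lebesgue lborel (reindex e) = lborel"
    using distr_completion[OF m] distr_reindex_lborel[OF assms] by simp
  show "reindex e \<in> lebesgue \<rightarrow>\<^sub>M lebesgue"
    by (rule completion.measurable_completion2[OF m']) (simp add: d)
  show "distr lebesgue lebesgue (reindex e) = lebesgue"
    using completion.completion_distr_eq[OF m'] d by simp
qed

text \<open>Conjugation by \<open>e\<close> is a sign-preserving bijection between the permutations of the two index types,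
so the two Leibniz sums agree term by term.\<close>

lemma det_reindex:
  fixes e :: "'k::finite \<Rightarrow> 'm::finite" and M :: "real ^ 'm ^ 'm"
  assumes e: "bij e"
  shows "det (\<chi> i j. M $ e i $ e j) = det M"
proof -
  have e': "bij_betw e UNIV UNIV" "inj e" using e by (auto simp: bij_is_inj)
  have ei: "bij_betw (inv e) UNIV UNIV" using e by (rule bij_imp_bij_inv)
  have "det M = (\<Sum>p | p permutes (UNIV :: 'k set).
      of_int (sign (map_permutation UNIV e p)) * (\<Prod>i\<in>UNIV. M $ i $ map_permutation UNIV e p i))"
    unfolding det_def
    by (rule sum.reindex_bij_betw[symmetric],
        rule bij_betw_byWitness[where f' = "map_permutation UNIV (inv e)"])
      (use e' e ei in \<open>auto simp: map_permutation_permutes map_permutation_compose_inv surj_f_inv_f bij_is_surj\<close>)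
  also have "\<dots> = (\<Sum>p | p permutes (UNIV :: 'k set). of_int (sign p) * (\<Prod>i\<in>UNIV. M $ e i $ e (p i)))"
  proof (rule sum.cong, simp)
    fix p :: "'k \<Rightarrow> 'k" assume "p \<in> {p. p permutes UNIV}"
    then have p: "p permutes UNIV" by simp
    have "sign (map_permutation UNIV e p) = sign p"
      by (rule sign_map_permutation) (use e' p in auto)
    moreover have "(\<Prod>i\<in>UNIV. M $ i $ map_permutation UNIV e p i) = (\<Prod>i\<in>UNIV. M $ e i $ map_permutation UNIV e p (e i))"
      by (rule prod.reindex_bij_betw[OF e'(1), symmetric])
    ultimately show "of_int (sign (map_permutation UNIV e p)) * (\<Prod>i\<in>UNIV. M $ i $ map_permutation UNIV e p i)
        = of_int (sign p) * (\<Prod>i\<in>UNIV. M $ e i $ e (p i))"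
      using e' by (simp add: map_permutation_apply)
  qed
  finally show ?thesis by (simp add: det_def)
qed


lemma det_matrix_reindex_conjugate:
  fixes e :: "'k::finite \<Rightarrow> 'm::finite" and L :: "real ^ 'm \<Rightarrow> real ^ 'm"
  assumes e: "bij e"
  shows "det (matrix (\<lambda>v. reindex e (L (reindex (inv e) v)))) = det (matrix L)"
proof -
  have "reindex (inv e) (axis j 1 :: real ^ 'k) = axis (e j) 1" for j
  proof -
    have "axis j 1 = reindex e (axis (e j) 1 :: real ^ 'm)"
      using bij_is_inj[OF e] by (auto simp: vec_eq_iff axis_def inj_eq)
    then show ?thesis by (simp add: reindex_inv[OF e])
  qed
  then have "matrix (\<lambda>v. reindex e (L (reindex (inv e) v))) = (\<chi> i j. matrix L $ e i $ e j)"
    by (simp add: matrix_def)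
  then show ?thesis
    by (simp add: det_reindex[OF e])
qed

lemma emeasure_differentiable_image_wellorder:
  fixes g :: "real ^ 'k::{finite,wellorder} \<Rightarrow> real ^ 'k::_"
  assumes A: "A \<in> sets lebesgue"
    and der: "\<And>x. x \<in> A \<Longrightarrow> (g has_derivative g' x) (at x within A)"
    and inj: "inj_on g A" and fin: "g ` A \<in> lmeasurable"
  shows "emeasure lebesgue (g ` A) = (\<integral>\<^sup>+ x. ennreal \<bar>det (matrix (g' x))\<bar> * indicator A x \<partial>lebesgue)"
proof -
  have "((\<lambda>x. \<bar>det (matrix (g' x))\<bar>) has_integral measure lebesgue (g ` A)) A"
    using has_measure_differentiable_image[OF A der inj] fin by blast
  then have "(\<integral>\<^sup>+ x. ennreal (indicator A x * \<bar>det (matrix (g' x))\<bar>) \<partial>lborel) = ennreal (measure lebesgue (g ` A))"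
    by (intro nn_integral_has_integral_lebesgue) auto
  also have "(\<integral>\<^sup>+ x. ennreal (indicator A x * \<bar>det (matrix (g' x))\<bar>) \<partial>lborel)
      = (\<integral>\<^sup>+ x. ennreal \<bar>det (matrix (g' x))\<bar> * indicator A x \<partial>lebesgue)"
    unfolding nn_integral_completion by (intro nn_integral_cong) (auto simp: indicator_def)
  finally show ?thesis
    using fin by (simp add: emeasure_eq_measure2 fmeasurableD2)
qed

text \<open>Both facts are transferred from the well-ordered copy of the index type by conjugating \<open>g\<close> with the
relabelling of coordinates.\<close>

lemma
  fixes g :: "real ^ 'm \<Rightarrow> real ^ 'm"
  assumes A: "A \<in> sets lebesgue"
    and der: "\<And>x. x \<in> A \<Longrightarrow> (g has_derivative g' x) (at x within A)"
    and inj: "inj_on g A" and fin: "g ` A \<in> lmeasurable"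
  shows measurable_det_derivative:
      "(\<lambda>x. ennreal \<bar>det (matrix (g' x))\<bar> * indicator A x) \<in> borel_measurable lebesgue"
    and emeasure_differentiable_image:
      "emeasure lebesgue (g ` A) = (\<integral>\<^sup>+ x. ennreal \<bar>det (matrix (g' x))\<bar> * indicator A x \<partial>lebesgue)"
proof -
  obtain e :: "'m coord_index \<Rightarrow> 'm" where e: "bij e"
    using bij_coord_index by blast
  have ei: "bij (inv e)" using e by (rule bij_imp_bij_inv)
  let ?R = "reindex e" and ?R' = "reindex (inv e)"
  have RR: "?R (?R' v) = v" "?R' (?R w) = w" for v w
    using reindex_inv[OF e] by auto
  have injR: "inj ?R" by (metis RR(2) injI)
  have mR: "?R \<in> lebesgue \<rightarrow>\<^sub>M lebesgue" and mR': "?R' \<in> lebesgue \<rightarrow>\<^sub>M lebesgue"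
    using measurable_reindex_lebesgue[OF e] measurable_reindex_lebesgue[OF ei] by auto
  define G where "G y = ?R (g (?R' y))" for y
  define G' where "G' y v = ?R (g' (?R' y) (?R' v))" for y v
  have img: "?R ` B = ?R' -` B" for B
    by (force simp: RR image_iff)
  have vR: "?R -` (?R ` B) = B" for B
    using injR by (rule inj_vimage_image_eq)
  have sets_img: "?R ` B \<in> sets lebesgue" if "B \<in> sets lebesgue" for B
    using measurable_sets[OF mR' that] by (simp add: img)
  have em: "emeasure lebesgue (?R ` B) = emeasure lebesgue B" if "B \<in> sets lebesgue" for B
  proof -
    have "emeasure lebesgue (?R ` B) = emeasure (distr lebesgue lebesgue ?R) (?R ` B)"
      by (simp add: distr_reindex_lebesgue[OF e])
    also have "\<dots> = emeasure lebesgue B"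
      using sets_img[OF that] mR by (simp add: emeasure_distr vR)
    finally show ?thesis .
  qed
  have GA: "G ` ?R ` A = ?R ` g ` A"
    by (auto simp: G_def RR image_image)
  have gA: "g ` A \<in> sets lebesgue" using fin by blast
  have GA_fin: "G ` ?R ` A \<in> lmeasurable"
    using fin sets_img[OF gA] em[OF gA] by (auto simp: GA fmeasurable_def)
  have derR: "(?R has_derivative ?R) F" and derR': "(?R' has_derivative ?R') F'" for F F'
    by (auto intro!: bounded_linear_imp_has_derivative linear_reindex simp: linear_conv_bounded_linear[symmetric])
  have derG: "(G has_derivative G' y) (at y within ?R ` A)" if y: "y \<in> ?R ` A" for y
  proof -
    have A_img: "?R' ` ?R ` A = A" by (auto simp: RR image_image)
    have "?R' y \<in> A" using y by (auto simp: RR)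
    then have "(g has_derivative g' (?R' y)) (at (?R' y) within ?R' ` ?R ` A)"
      unfolding A_img by (rule der)
    from has_derivative_in_compose[OF derR' this]
    have "((\<lambda>y. g (?R' y)) has_derivative (\<lambda>v. g' (?R' y) (?R' v))) (at y within ?R ` A)" .
    from has_derivative_in_compose[OF this derR] show ?thesis
      by (simp add: G_def[abs_def] G'_def[abs_def])
  qed
  have injG: "inj_on G (?R ` A)"
    using inj by (auto simp: inj_on_def G_def RR injR[THEN inj_eq])
  have detG: "det (matrix (G' (?R x))) = det (matrix (g' x))" for x
    unfolding G'_def RR by (rule det_matrix_reindex_conjugate[OF e])
  have indR: "indicator (?R ` A) (?R x) = (indicator A x :: ennreal)" for x
    using injR by (auto simp: indicator_def inj_image_mem_iff)
  have mdet: "(\<lambda>y. ennreal \<bar>det (matrix (G' y))\<bar> * indicator (?R ` A) y) \<in> borel_measurable lebesgue"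
    using borel_measurable_det_Jacobian[OF sets_img[OF A] derG] sets_img[OF A]
    by (subst borel_measurable_restrict_space_iff_ennreal[symmetric]) auto
  show "(\<lambda>x. ennreal \<bar>det (matrix (g' x))\<bar> * indicator A x) \<in> borel_measurable lebesgue"
    using measurable_compose[OF mR mdet] by (simp add: detG indR)
  have "emeasure lebesgue (g ` A) = emeasure lebesgue (G ` ?R ` A)"
    by (simp add: GA em[OF gA])
  also have "\<dots> = (\<integral>\<^sup>+ y. ennreal \<bar>det (matrix (G' y))\<bar> * indicator (?R ` A) y \<partial>lebesgue)"
    by (rule emeasure_differentiable_image_wellorder[OF sets_img[OF A] derG injG GA_fin])
  also have "\<dots> = (\<integral>\<^sup>+ y. ennreal \<bar>det (matrix (G' y))\<bar> * indicator (?R ` A) y \<partial>distr lebesgue lebesgue ?R)"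
    by (simp add: distr_reindex_lebesgue[OF e])
  also have "\<dots> = (\<integral>\<^sup>+ x. ennreal \<bar>det (matrix (g' x))\<bar> * indicator A x \<partial>lebesgue)"
    using mdet by (subst nn_integral_distr[OF mR]) (auto simp: detG indR)
  finally show "emeasure lebesgue (g ` A) = (\<integral>\<^sup>+ x. ennreal \<bar>det (matrix (g' x))\<bar> * indicator A x \<partial>lebesgue)" .
qed

text \<open>The formula for the measure of images says that the left inverse \<open>\<tau>\<close> transports Lebesgue measure on
the image to the measure on \<open>X\<close> with density the absolute value of the Jacobian determinant.
Integrating against both measures gives the change of variables for all nonnegative functions.\<close>

lemma nn_integral_left_inverse:
  fixes g :: "real ^ 'm \<Rightarrow> real ^ 'm"
  assumes X: "X \<in> sets lebesgue"
    and der: "\<And>x. x \<in> X \<Longrightarrow> (g has_derivative g' x) (at x within X)"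
    and bnd: "bounded (g ` X)" and inv: "\<And>x. x \<in> X \<Longrightarrow> \<tau> (g x) = x"
    and w: "w \<in> borel_measurable (lebesgue_on X)"
  shows "(\<integral>\<^sup>+ y. w (\<tau> y) \<partial>lebesgue_on (g ` X)) = (\<integral>\<^sup>+ x. ennreal \<bar>det (matrix (g' x))\<bar> * w x \<partial>lebesgue_on X)"
proof -
  have diff: "g differentiable_on A" if "A \<subseteq> X" for A
    using der that has_derivative_subset[OF der that]
    by (auto simp: differentiable_on_def differentiable_def)
  have leb: "g ` A \<in> sets lebesgue" if "A \<in> sets lebesgue" "A \<subseteq> X" for A
    by (rule differentiable_image_in_sets_lebesgue) (use that diff in auto)
  have inj: "inj_on g X" using inv by (metis inj_onI)
  have pre: "\<tau> -` A \<inter> g ` X = g ` A" if "A \<subseteq> X" for A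
    using that inv by force
  have meas: "\<tau> \<in> lebesgue_on (g ` X) \<rightarrow>\<^sub>M lebesgue_on X"
  proof (rule measurableI)
    fix A assume "A \<in> sets (lebesgue_on X)"
    then have A: "A \<in> sets lebesgue" "A \<subseteq> X"
      using X by (auto simp: sets_restrict_space_iff)
    show "\<tau> -` A \<inter> space (lebesgue_on (g ` X)) \<in> sets (lebesgue_on (g ` X))"
      using leb[OF A] leb[OF X] A by (auto simp: pre sets_restrict_space_iff)
  qed (auto simp: inv)
  have lm: "g ` A \<in> lmeasurable" if "A \<in> sets lebesgue" "A \<subseteq> X" for A
    by (rule bounded_set_imp_lmeasurable) (use leb that bnd in \<open>auto intro: bounded_subset\<close>)
  have det: "(\<lambda>x. ennreal \<bar>det (matrix (g' x))\<bar>) \<in> borel_measurable (lebesgue_on X)"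
    using measurable_det_derivative[OF X der inj lm[OF X]] X
    by (subst borel_measurable_restrict_space_iff_ennreal) auto
  have "distr (lebesgue_on (g ` X)) (lebesgue_on X) \<tau> = density (lebesgue_on X) (\<lambda>x. ennreal \<bar>det (matrix (g' x))\<bar>)"
  proof (rule measure_eqI)
    fix A assume "A \<in> sets (distr (lebesgue_on (g ` X)) (lebesgue_on X) \<tau>)"
    then have A': "A \<in> sets (lebesgue_on X)" by simp
    then have A: "A \<in> sets lebesgue" "A \<subseteq> X"
      using X by (auto simp: sets_restrict_space_iff)
    have "emeasure (distr (lebesgue_on (g ` X)) (lebesgue_on X) \<tau>) A = emeasure lebesgue (g ` A)"
      using A A' leb[OF A] leb[OF X] meas by (simp add: emeasure_distr pre emeasure_restrict_space image_mono)
    also have "\<dots> = (\<integral>\<^sup>+ x. ennreal \<bar>det (matrix (g' x))\<bar> * indicator A x \<partial>lebesgue)"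
      by (rule emeasure_differentiable_image)
        (use A lm inj in \<open>auto intro: has_derivative_subset[OF der] inj_on_subset\<close>)
    also have "\<dots> = (\<integral>\<^sup>+ x. ennreal \<bar>det (matrix (g' x))\<bar> * indicator A x \<partial>lebesgue_on X)"
      using X A by (subst nn_integral_restrict_space)
        (auto intro!: nn_integral_cong simp: indicator_def)
    also have "\<dots> = emeasure (density (lebesgue_on X) (\<lambda>x. ennreal \<bar>det (matrix (g' x))\<bar>)) A"
      using A' det by (simp add: emeasure_density)
    finally show "emeasure (distr (lebesgue_on (g ` X)) (lebesgue_on X) \<tau>) A
        = emeasure (density (lebesgue_on X) (\<lambda>x. ennreal \<bar>det (matrix (g' x))\<bar>)) A" .
  qed simp
  then show "(\<integral>\<^sup>+ y. w (\<tau> y) \<partial>lebesgue_on (g ` X)) = (\<integral>\<^sup>+ x. ennreal \<bar>det (matrix (g' x))\<bar> * w x \<partial>lebesgue_on X)"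
    using nn_integral_distr[OF meas, of w] nn_integral_density[OF det w] w by simp
qed

section \<open>Systems of diffeomorphic branches\<close>

lemma C1_diffeo_extension_has_derivative:
  assumes "C1_diffeo_extension X h g" and x: "x \<in> X"
  shows "(h has_derivative (\<lambda>v. jacobian g (at x) *v v)) (at x within X)"
proof -
  obtain U V where UV: "X \<subseteq> U" "C1_diffeo U V g" and eq: "\<And>x. x \<in> X \<Longrightarrow> h x = g x"
    using assms(1) unfolding C1_diffeo_extension_def by blast
  have "open U" "g differentiable_on U" using UV(2) by (auto simp: C1_diffeo_def C1_on_def)
  then have "g differentiable at x" using UV(1) x
    by (metis at_within_open differentiable_on_def subsetD)
  then have der: "(g has_derivative (\<lambda>v. jacobian g (at x) *v v)) (at x within X)"
    by (auto simp: jacobian_works intro: has_derivative_at_withinI)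
  show ?thesis
    by (rule has_derivative_transform[OF x eq der])
qed

lemma C1_diffeo_extension_inj_on:
  assumes "C1_diffeo_extension X h g"
  shows "inj_on h X"
  using assms unfolding C1_diffeo_extension_def C1_diffeo_def bij_betw_def inj_on_def
  by (metis subsetD)

text \<open>Differentiable maps send null sets to null sets. Applied to \<open>h\<close> and, in the lemma after this one, to
the inverse of the extension \<open>g\<close>, this makes statements almost everywhere transferable in both
directions.\<close>

lemma C1_diffeo_extension_negligible_image:
  assumes ext: "C1_diffeo_extension X h g" and N: "negligible N" "N \<subseteq> X"
  shows "negligible (h ` N)"
proof -
  have "h differentiable_on N"
    using C1_diffeo_extension_has_derivative[OF ext] N(2)
    by (meson differentiable_def differentiable_on_def differentiable_on_subset)
  then show ?thesis
    using N(1) by (intro negligible_differentiable_image_negligible) auto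
qed

lemma C1_diffeo_extension_negligible_vimage:
  assumes ext: "C1_diffeo_extension X h g" and N: "negligible N"
  shows "negligible {x \<in> X. h x \<in> N}"
proof -
  obtain U V where UV: "X \<subseteq> U" "C1_diffeo U V g" and eq: "\<And>x. x \<in> X \<Longrightarrow> h x = g x"
    using ext unfolding C1_diffeo_extension_def by blast
  have bij: "bij_betw g U V" and diff: "the_inv_into U g differentiable_on V"
    using UV(2) by (auto simp: C1_diffeo_def C1_on_def)
  have "negligible (the_inv_into U g ` (N \<inter> V))"
    using N diff by (intro negligible_differentiable_image_negligible)
      (auto intro: differentiable_on_subset negligible_subset)
  moreover have "{x \<in> X. h x \<in> N} \<subseteq> the_inv_into U g ` (N \<inter> V)"
  proof
    fix x assume x: "x \<in> {x \<in> X. h x \<in> N}"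
    then have "x = the_inv_into U g (g x)" "g x \<in> N \<inter> V"
      using UV(1) bij eq by (auto simp: bij_betw_def the_inv_into_f_f)
    then show "x \<in> the_inv_into U g ` (N \<inter> V)" by blast
  qed
  ultimately show ?thesis by (rule negligible_subset)
qed

lemma AE_lebesgue_on_iff_negligible:
  assumes "X \<in> sets lebesgue"
  shows "(AE x in lebesgue_on X. P x) \<longleftrightarrow> negligible {x \<in> X. \<not> P x}"
proof -
  interpret complete_measure "lebesgue_on X" by (rule complete_measure_lebesgue_on[OF assms])
  show ?thesis
    using assms by (auto simp: AE_iff_null_sets null_sets_restrict_space negligible_iff_null_sets)
qed

text \<open>The maps \<open>h i\<close> are the inverse branches of one map \<open>shift\<close> of \<open>X\<close> to itself, whose restriction to
\<open>h i ` X\<close> undoes \<open>h i\<close>. In terms of it, the Read-Bajraktarevic operator has the form studied for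
\<^locale>\<open>affine_recursion\<close>.\<close>

locale C1_branches =
  fixes X :: "(real ^ 'm) set" and n :: nat and h g :: "nat \<Rightarrow> real ^ 'm \<Rightarrow> real ^ 'm"
  assumes bounded: "bounded X" and lebesgue: "X \<in> sets lebesgue"
    and ext: "\<And>i. i \<in> {1..n} \<Longrightarrow> C1_diffeo_extension X (h i) (g i)"
    and disj: "disjoint_family_on (\<lambda>i. h i ` X) {1..n}"
    and cover: "X = (\<Union>i\<in>{1..n}. h i ` X)"
begin

definition branch :: "real ^ 'm \<Rightarrow> nat" where
  "branch y = (THE i. i \<in> {1..n} \<and> y \<in> h i ` X)"

definition shift :: "real ^ 'm \<Rightarrow> real ^ 'm" where
  "shift y = the_inv_into X (h (branch y)) y"

lemma branch_eq:
  assumes "i \<in> {1..n}" "y \<in> h i ` X"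
  shows "branch y = i"
  unfolding branch_def
proof (rule the_equality)
  fix j assume "j \<in> {1..n} \<and> y \<in> h j ` X"
  then show "j = i"
    using assms disjoint_family_onD[OF disj, of j i] by blast
qed (use assms in simp)

lemma shift_eq:
  assumes i: "i \<in> {1..n}" and "x \<in> X"
  shows "shift (h i x) = x"
  using assms branch_eq[OF i, of "h i x"] C1_diffeo_extension_inj_on[OF ext[OF i]]
  by (simp add: shift_def the_inv_into_f_f)

lemma h_in: "i \<in> {1..n} \<Longrightarrow> x \<in> X \<Longrightarrow> h i x \<in> X"
  using cover by blast

lemma piece:
  assumes y: "y \<in> X"
  obtains i x where "i \<in> {1..n}" "x \<in> X" "y = h i x"
  using y cover by blast

lemma h_image_lebesgue:
  assumes i: "i \<in> {1..n}" and A: "A \<in> sets lebesgue" "A \<subseteq> X"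
  shows "h i ` A \<in> sets lebesgue"
proof (rule differentiable_image_in_sets_lebesgue[OF A(1)])
  show "h i differentiable_on A"
    using C1_diffeo_extension_has_derivative[OF ext[OF i]] A(2)
    by (meson differentiable_def differentiable_on_def differentiable_on_subset)
qed simp

lemma shift_in: "y \<in> X \<Longrightarrow> shift y \<in> X"
  by (erule piece) (simp add: shift_eq)

lemma shift_vimage:
  assumes A: "A \<subseteq> X"
  shows "shift -` A \<inter> X = (\<Union>i\<in>{1..n}. h i ` A)"
proof (intro equalityI subsetI)
  fix y assume y: "y \<in> shift -` A \<inter> X"
  then obtain i x where ix: "i \<in> {1..n}" "x \<in> X" "y = h i x"
    using piece by blast
  then have "x \<in> A" using y shift_eq by simp
  then show "y \<in> (\<Union>i\<in>{1..n}. h i ` A)" using ix by blast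
next
  fix y assume "y \<in> (\<Union>i\<in>{1..n}. h i ` A)"
  then obtain i x where "i \<in> {1..n}" "x \<in> A" "y = h i x" by blast
  then show "y \<in> shift -` A \<inter> X" using A shift_eq h_in by auto
qed

lemma shift_measurable: "shift \<in> lebesgue_on X \<rightarrow>\<^sub>M lebesgue_on X"
proof (rule measurableI)
  fix A assume "A \<in> sets (lebesgue_on X)"
  then have "A \<in> sets lebesgue" "A \<subseteq> X"
    using lebesgue by (auto simp: sets_restrict_space_iff)
  then show "shift -` A \<inter> space (lebesgue_on X) \<in> sets (lebesgue_on X)"
    using lebesgue h_image_lebesgue h_in by (auto simp: shift_vimage sets_restrict_space_iff intro!: sets.finite_UN)
qed (simp add: shift_in)

lemma shift_nonsingular:
  assumes "AE y in lebesgue_on X. P y"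
  shows "AE y in lebesgue_on X. P (shift y)"
proof -
  have "negligible (\<Union>i\<in>{1..n}. h i ` {x \<in> X. \<not> P x})"
    using assms C1_diffeo_extension_negligible_image[OF ext]
    by (intro negligible_Union) (auto simp: AE_lebesgue_on_iff_negligible[OF lebesgue])
  moreover have "{y \<in> X. \<not> P (shift y)} \<subseteq> (\<Union>i\<in>{1..n}. h i ` {x \<in> X. \<not> P x})"
    using shift_vimage[of "{x \<in> X. \<not> P x}"] shift_in by blast
  ultimately show ?thesis
    unfolding AE_lebesgue_on_iff_negligible[OF lebesgue] by (rule negligible_subset)
qed

lemma AE_lebesgue_on_iff_branches:
  "(AE y in lebesgue_on X. P y) \<longleftrightarrow> (\<forall>i\<in>{1..n}. AE x in lebesgue_on X. P (h i x))"
  unfolding AE_lebesgue_on_iff_negligible[OF lebesgue]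
proof (intro iffI ballI)
  fix i assume neg: "negligible {y \<in> X. \<not> P y}" and i: "i \<in> {1..n}"
  show "negligible {x \<in> X. \<not> P (h i x)}"
    by (rule negligible_subset[OF C1_diffeo_extension_negligible_vimage[OF ext[OF i] neg]])
      (use i h_in in blast)
next
  assume "\<forall>i\<in>{1..n}. negligible {x \<in> X. \<not> P (h i x)}"
  then have "negligible (\<Union>i\<in>{1..n}. h i ` {x \<in> X. \<not> P (h i x)})"
    using C1_diffeo_extension_negligible_image[OF ext] by (intro negligible_Union) auto
  then show "negligible {y \<in> X. \<not> P y}"
  proof (rule negligible_subset)
    show "{y \<in> X. \<not> P y} \<subseteq> (\<Union>i\<in>{1..n}. h i ` {x \<in> X. \<not> P (h i x)})"
    proof
      fix y assume y: "y \<in> {y \<in> X. \<not> P y}"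
      then obtain i x where "i \<in> {1..n}" "x \<in> X" "y = h i x"
        using piece by blast
      with y show "y \<in> (\<Union>i\<in>{1..n}. h i ` {x \<in> X. \<not> P (h i x)})" by blast
    qed
  qed
qed

lemma sum_pieces_eq_branch:
  assumes y: "y \<in> X"
  shows "(\<Sum>i\<in>{1..n}. if y \<in> h i ` X then F i else (0::'z::comm_monoid_add)) = F (branch y)"
proof -
  obtain j where j: "j \<in> {1..n}" "y \<in> h j ` X"
    using y cover by blast
  have "(y \<in> h i ` X) = (i = j)" if "i \<in> {1..n}" for i
    using that j(1) branch_eq[OF that, of y] branch_eq[OF j] j(2) by auto
  then have "(\<Sum>i\<in>{1..n}. if y \<in> h i ` X then F i else 0) = (\<Sum>i\<in>{1..n}. if i = j then F i else 0)"
    by (intro sum.cong refl) simp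
  also have "\<dots> = F j" using j by simp
  also have "j = branch y" using branch_eq[OF j] by simp
  finally show ?thesis .
qed

text \<open>On the piece \<open>h i ` X\<close> the integrand is \<open>F i \<circ> shift\<close>; the change of variables \<open>y = h i x\<close> takes each
piece back to all of \<open>X\<close>, at the cost of the Jacobian determinant.\<close>

lemma nn_integral_branches:
  assumes F: "\<And>i. i \<in> {1..n} \<Longrightarrow> F i \<in> borel_measurable (lebesgue_on X)"
  shows "(\<integral>\<^sup>+ y. F (branch y) (shift y) \<partial>lebesgue_on X)
    = (\<Sum>i=1..n. \<integral>\<^sup>+ x. ennreal \<bar>det (jacobian (g i) (at x))\<bar> * F i x \<partial>lebesgue_on X)"
proof -
  have pm: "(\<lambda>y. if y \<in> h i ` X then F i (shift y) else 0) \<in> borel_measurable (lebesgue_on X)" if i: "i \<in> {1..n}" for i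
  proof (rule measurable_If_set)
    show "(\<lambda>y. F i (shift y)) \<in> borel_measurable (lebesgue_on X)"
      by (rule measurable_compose[OF shift_measurable F[OF i]])
    have "h i ` X \<subseteq> X" using i h_in by blast
    then show "h i ` X \<inter> space (lebesgue_on X) \<in> sets (lebesgue_on X)"
      using h_image_lebesgue[OF i lebesgue] lebesgue by (auto simp: sets_restrict_space_iff)
  qed simp
  have "(\<integral>\<^sup>+ y. F (branch y) (shift y) \<partial>lebesgue_on X)
      = (\<integral>\<^sup>+ y. (\<Sum>i\<in>{1..n}. if y \<in> h i ` X then F i (shift y) else 0) \<partial>lebesgue_on X)"
    by (rule nn_integral_cong) (rule sum_pieces_eq_branch[of _ "\<lambda>i. F i (shift _)", symmetric], simp)
  also have "\<dots> = (\<Sum>i\<in>{1..n}. \<integral>\<^sup>+ y. (if y \<in> h i ` X then F i (shift y) else 0) \<partial>lebesgue_on X)"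
    by (rule nn_integral_sum[OF pm])
  also have "\<dots> = (\<Sum>i\<in>{1..n}. \<integral>\<^sup>+ x. ennreal \<bar>det (jacobian (g i) (at x))\<bar> * F i x \<partial>lebesgue_on X)"
  proof (rule sum.cong[OF refl])
    fix i assume i: "i \<in> {1..n}"
    have sub: "h i ` X \<subseteq> X" using i h_in by blast
    have leb: "h i ` X \<in> sets lebesgue" by (rule h_image_lebesgue[OF i lebesgue subset_refl])
    have "(\<integral>\<^sup>+ y. (if y \<in> h i ` X then F i (shift y) else 0) \<partial>lebesgue_on X)
        = (\<integral>\<^sup>+ y. F i (shift y) \<partial>lebesgue_on (h i ` X))"
    proof -
      have "(if y \<in> h i ` X then F i (shift y) else 0) * indicator X y
          = F i (shift y) * indicator (h i ` X) y" for y
        using sub by (simp add: indicator_def subset_iff)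
      then show ?thesis
        using leb lebesgue by (simp add: nn_integral_restrict_space)
    qed
    also have "\<dots> = (\<integral>\<^sup>+ x. ennreal \<bar>det (matrix ((*v) (jacobian (g i) (at x))))\<bar> * F i x \<partial>lebesgue_on X)"
      by (rule nn_integral_left_inverse[OF lebesgue C1_diffeo_extension_has_derivative[OF ext[OF i]]
            bounded_subset[OF bounded sub] shift_eq[OF i] F[OF i]])
    finally show "(\<integral>\<^sup>+ y. (if y \<in> h i ` X then F i (shift y) else 0) \<partial>lebesgue_on X)
        = (\<integral>\<^sup>+ x. ennreal \<bar>det (jacobian (g i) (at x))\<bar> * F i x \<partial>lebesgue_on X)"
      by (simp add: matrix_of_matrix_vector_mul)
  qed
  finally show ?thesis .
qed

lemma bochner_measurable_branches:
  fixes F :: "nat \<Rightarrow> real ^ 'm \<Rightarrow> 'b::real_normed_vector"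
  assumes F: "\<And>i. i \<in> {1..n} \<Longrightarrow> bochner_measurable (lebesgue_on X) (F i)"
  shows "bochner_measurable (lebesgue_on X) (\<lambda>y. F (branch y) (shift y))"
proof -
  show ?thesis
  proof (rule bochner_measurable_cong)
    show "(\<Sum>i\<in>{1..n}. indicator (h i ` X) y *\<^sub>R F i (shift y)) = F (branch y) (shift y)"
      if "y \<in> space (lebesgue_on X)" for y
    proof -
      have "(\<Sum>i\<in>{1..n}. indicator (h i ` X) y *\<^sub>R F i (shift y))
          = (\<Sum>i\<in>{1..n}. if y \<in> h i ` X then F i (shift y) else 0)"
        by (intro sum.cong) (auto simp: indicator_def)
      then show ?thesis
        using that sum_pieces_eq_branch[of y "\<lambda>i. F i (shift y)"] by simp
    qed
    show "bochner_measurable (lebesgue_on X) (\<lambda>y. \<Sum>i\<in>{1..n}. indicator (h i ` X) y *\<^sub>R F i (shift y))"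
  proof (intro bochner_measurable_sum bochner_measurable_scaleR bochner_measurable_indicator)
    fix i assume i: "i \<in> {1..n}"
    have "h i ` X \<subseteq> X" using i h_in by blast
    then show "h i ` X \<in> sets (lebesgue_on X)"
      using h_image_lebesgue[OF i lebesgue] lebesgue by (auto simp: sets_restrict_space_iff)
    show "bochner_measurable (lebesgue_on X) (\<lambda>y. F i (shift y))"
      by (rule bochner_measurable_comp[OF F[OF i] shift_measurable shift_nonsingular])
  qed
  qed
qed

lemma RB_operator_eq:
  "RB_operator X n h q s f y = q (branch y) (shift y) + s (branch y) (shift y) *\<^sub>R f (shift y)"
  by (simp add: RB_operator_def branch_def shift_def Let_def)

text \<open>Evaluating the fixed point equation at \<open>y = h i x\<close> gives the \<open>i\<close>-th equation of the system, and
the two notions of almost everywhere correspond because the \<open>h i\<close> preserve null sets in both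
directions.\<close>

lemma solves_fif_system_iff_fixed_point:
  "solves_fif_system X n h q s \<phi> \<longleftrightarrow> (AE y in lebesgue_on X. RB_operator X n h q s \<phi> y = \<phi> y)"
proof -
  have "(AE x in lebesgue_on X. \<phi> (h i x) = q i x + s i x *\<^sub>R \<phi> x)
      \<longleftrightarrow> (AE x in lebesgue_on X. RB_operator X n h q s \<phi> (h i x) = \<phi> (h i x))" if i: "i \<in> {1..n}" for i
    by (intro AE_cong) (auto simp: RB_operator_eq shift_eq[OF i] branch_eq[OF i])
  then show ?thesis
    unfolding solves_fif_system_def AE_lebesgue_on_iff_branches[of "\<lambda>y. RB_operator X n h q s \<phi> y = \<phi> y"]
    by (rule ball_cong[OF refl])
qed

text \<open>Each branch contributes its Jacobian determinant, from the change of variables, times the power of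
\<open>s i\<close>; \<^const>\<open>fif_gamma\<close> for finite \<open>p\<close> is the sum of the suprema of these products.\<close>

lemma RB_contraction:
  fixes s :: "nat \<Rightarrow> real ^ 'm \<Rightarrow> real"
  assumes p: "p \<noteq> \<infinity>" and s: "\<And>i. i \<in> {1..n} \<Longrightarrow> s i \<in> borel_measurable (lebesgue_on X)"
    and w: "w \<in> borel_measurable (lebesgue_on X)"
  shows "(\<integral>\<^sup>+ y. ennreal (\<bar>s (branch y) (shift y)\<bar> powr enn2real p) * w (shift y) \<partial>lebesgue_on X)
    \<le> fif_gamma p X n g s * (\<integral>\<^sup>+ y. w y \<partial>lebesgue_on X)"
proof -
  let ?r = "enn2real p"
  let ?J = "\<lambda>i x. \<bar>det (jacobian (g i) (at x))\<bar>"
  let ?c = "\<lambda>i. SUP x\<in>X. ennreal (?J i x * \<bar>s i x\<bar> powr ?r)"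
  have "(\<integral>\<^sup>+ y. ennreal (\<bar>s (branch y) (shift y)\<bar> powr ?r) * w (shift y) \<partial>lebesgue_on X)
      = (\<Sum>i=1..n. \<integral>\<^sup>+ x. ennreal (?J i x) * (ennreal (\<bar>s i x\<bar> powr ?r) * w x) \<partial>lebesgue_on X)"
    using s w by (intro nn_integral_branches) measurable
  also have "\<dots> \<le> (\<Sum>i=1..n. \<integral>\<^sup>+ x. ?c i * w x \<partial>lebesgue_on X)"
  proof (intro sum_mono nn_integral_mono)
    fix i x assume "x \<in> space (lebesgue_on X)"
    then have "ennreal (?J i x * \<bar>s i x\<bar> powr ?r) \<le> ?c i"
      by (intro SUP_upper) simp
    then show "ennreal (?J i x) * (ennreal (\<bar>s i x\<bar> powr ?r) * w x) \<le> ?c i * w x"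
      by (simp add: ennreal_mult' mult.assoc[symmetric] mult_right_mono)
  qed
  also have "\<dots> = fif_gamma p X n g s * (\<integral>\<^sup>+ y. w y \<partial>lebesgue_on X)"
    using p w by (simp add: fif_gamma_def nn_integral_cmult sum_distrib_right)
  finally show ?thesis .
qed

end

section \<open>The fractal interpolation problem\<close>

theorem theorem4p1:
  fixes p :: ennreal
    and n :: nat
    and X :: "(real ^ 'm) set"
    and h g :: "nat \<Rightarrow> real ^ 'm \<Rightarrow> real ^ 'm"
    and q :: "nat \<Rightarrow> real ^ 'm \<Rightarrow> 'f::banach"
    and s :: "nat \<Rightarrow> real ^ 'm \<Rightarrow> real"
  assumes "0 < p"
    and "1 \<le> n"
    and "X \<noteq> {}" and "bounded X" and "X \<in> sets lebesgue"
    and "\<And>i. i \<in> {1..n} \<Longrightarrow> C1_diffeo_extension X (h i) (g i)"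
    and "disjoint_family_on (\<lambda>i. h i ` X) {1..n}"
    and "X = (\<Union>i\<in>{1..n}. h i ` X)"
    and "\<And>i. i \<in> {1..n} \<Longrightarrow> q i \<in> Lp_space p (lebesgue_on X)"
    and "\<And>i. i \<in> {1..n} \<Longrightarrow> s i \<in> Lp_space \<infinity> (lebesgue_on X)"
    and "fif_gamma p X n g s < 1"
    (* Implied by the L^p assumption on q if the Jacobian determinants are bounded on X. *)
    and "\<And>i. i \<in> {1..n} \<Longrightarrow> p \<noteq> \<infinity> \<Longrightarrow>
           (\<integral>\<^sup>+ x. ennreal (\<bar>det (jacobian (g i) (at x))\<bar> * norm (q i x) powr enn2real p)
              \<partial>lebesgue_on X) < \<infinity>"
  shows "\<exists>\<psi> \<in> Lp_space p (lebesgue_on X).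
           (\<forall>\<phi> \<in> Lp_space p (lebesgue_on X).
              solves_fif_system X n h q s \<phi> \<longleftrightarrow> (AE x in lebesgue_on X. \<phi> x = \<psi> x)) \<and>
           (\<forall>\<phi> \<in> Lp_space p (lebesgue_on X).
              (AE x in lebesgue_on X. RB_operator X n h q s \<phi> x = \<phi> x) \<longleftrightarrow>
              (AE x in lebesgue_on X. \<phi> x = \<psi> x))"
proof -
  interpret C1_branches X n h g
    by standard (use assms in auto)
  have fin: "finite_measure (lebesgue_on X)"
    using assms(4,5) by (intro finite_measure_lebesgue_on bounded_set_imp_lmeasurable)
  have compl: "complete_measure (lebesgue_on X)"
    by (rule complete_measure_lebesgue_on[OF assms(5)])
  interpret M: complete_measure "lebesgue_on X" by (rule compl)
  have bq: "bochner_measurable (lebesgue_on X) (q i)" and bs: "bochner_measurable (lebesgue_on X) (s i)"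
    if "i \<in> {1..n}" for i
    using assms(9,10)[OF that] by (auto simp: Lp_space_def)
  define Q where "Q y = q (branch y) (shift y)" for y
  define S where "S y = s (branch y) (shift y)" for y
  interpret R: affine_recursion "lebesgue_on X" shift S Q
  proof (intro affine_recursion.intro fin compl affine_recursion_axioms.intro shift_measurable shift_nonsingular)
    show "bochner_measurable (lebesgue_on X) S"
      unfolding S_def[abs_def] by (rule bochner_measurable_branches[OF bs])
    show "bochner_measurable (lebesgue_on X) Q"
      unfolding Q_def[abs_def] by (rule bochner_measurable_branches[OF bq])
  qed
  have "R.unique_Lp_solution p R.orbit_sum"
  proof (cases "p = \<infinity>")
    case True
    define c where "c = fif_gamma p X n g s"
    have c1: "c < 1" using assms(11) by (simp add: c_def)
    have c1': "enn2real c < 1"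
      using c1 by (cases c) (auto simp: ennreal_less_one_iff)
    have bound: "\<bar>s i x\<bar> \<le> enn2real c" if "i \<in> {1..n}" "x \<in> X" for i x
    proof -
      have "ennreal \<bar>s i x\<bar> \<le> (SUP x\<in>X. ennreal \<bar>s i x\<bar>)"
        using that by (intro SUP_upper)
      also have "\<dots> \<le> c"
        unfolding c_def fif_gamma_def using True that by (auto intro!: Max_ge)
      also have "c = ennreal (enn2real c)"
        using c1 by (simp add: less_top order_less_trans)
      finally show ?thesis by simp
    qed
    have "\<exists>C. \<forall>i\<in>{1..n}. AE y in lebesgue_on X. norm (q i y) \<le> C i"
      using assms(9) unfolding True M.Lp_space_infinity_iff by metis
    then obtain C where C: "\<And>i. i \<in> {1..n} \<Longrightarrow> AE y in lebesgue_on X. norm (q i y) \<le> C i"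
      by blast
    have "AE y in lebesgue_on X. norm (Q y) \<le> Max (C ` {1..n})"
    proof (subst AE_lebesgue_on_iff_branches, rule ballI)
      fix i assume i: "i \<in> {1..n}"
      have "C i \<le> Max (C ` {1..n})" using i by (intro Max_ge) auto
      then have "norm (Q (h i x)) \<le> Max (C ` {1..n})" if "norm (q i x) \<le> C i" "x \<in> X" for x
        using that by (simp only: Q_def shift_eq[OF i] branch_eq[OF i] imageI order_trans)
      with C[OF i] show "AE x in lebesgue_on X. norm (Q (h i x)) \<le> Max (C ` {1..n})"
        by (rule lebesgue_on_mono)
    qed
    then have "Q \<in> Lp_space \<infinity> (lebesgue_on X)"
      using R.bochner_Q unfolding M.Lp_space_infinity_iff by blast
    moreover have "\<bar>S y\<bar> \<le> enn2real c" if "y \<in> X" for y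
      using that by (rule piece) (simp add: S_def bound branch_eq shift_eq)
    ultimately show ?thesis
      unfolding True using c1'
      by (intro R.orbit_sum_unique_Lp_infinity[of "enn2real c"]) auto
  next
    case False
    have "(\<integral>\<^sup>+ y. ennreal (norm (Q y) powr enn2real p) \<partial>lebesgue_on X)
        = (\<Sum>i=1..n. \<integral>\<^sup>+ x. ennreal \<bar>det (jacobian (g i) (at x))\<bar> * ennreal (norm (q i x) powr enn2real p) \<partial>lebesgue_on X)"
      unfolding Q_def
      by (intro nn_integral_branches) (use M.borel_measurable_norm_bochner[OF bq] in measurable)
    also have "\<dots> < \<infinity>"
      using assms(12) False by (auto simp: ennreal_mult'[symmetric])
    finally have "Q \<in> Lp_space p (lebesgue_on X)"
      using R.bochner_Q by (simp add: Lp_space_finite_iff[OF False])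
    then show ?thesis
      using RB_contraction[OF False M.bochner_measurable_imp_borel[OF bs]]
      by (intro R.orbit_sum_unique_Lp_finite[OF assms(1) False assms(11)]) (auto simp: S_def)
  qed
  moreover have "(AE y in lebesgue_on X. RB_operator X n h q s \<phi> y = \<phi> y)
      \<longleftrightarrow> (AE y in lebesgue_on X. \<phi> y = Q y + S y *\<^sub>R \<phi> (shift y))" for \<phi>
    unfolding RB_operator_eq Q_def S_def by (simp add: eq_commute)
  ultimately show ?thesis
    unfolding R.unique_Lp_solution_def solves_fif_system_iff_fixed_point by blast
qed

end
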